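(* Let $n\in\mathbb{N}$, $n\ge 3$, and let $F$ be a connected graph of order $n$, with diameter at least $2$, having no pendant vertices. Then there exist infinitely many (pairwise non-isomorphic) $F$-irregular graphs.
   Context: All graphs are finite, undirected and simple (no loops, no multiple edges). The order of a graph is its number of vertices; a pendant vertex is a vertex of degree $1$. For graphs $F$ and $G$ and a vertex $v\in V(G)$, the $F$-degree of $v$ in $G$ is the number of subgraphs of $G$ (not necessarily induced) that are isomorphic to $F$ and contain $v$. The graph $G$ is $F$-irregular if the $F$-degrees of its vertices are pairwise distinct. *)

theory Defs
  imports "Graph_Theory.Graph_Theory"
begin

text \<open>
  A finite simple undirected graph is a \<open>pair_graph\<close>: every edge \<open>{u, v}\<close> is represented by the
  two arcs \<open>(u, v)\<close> and \<open>(v, u)\<close>. Hence walks, connectedness and isomorphisms are those of the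
  undirected graph, and the degree of a vertex is its \<open>out_degree\<close>.
\<close>

text \<open>
  With all arc costs 1, the cost of a shortest path is the usual distance, which is infinite
  between different components.
\<close>

definition graph_diameter :: "'a pair_pre_digraph \<Rightarrow> ereal" where
  "graph_diameter G = (SUP u\<in>pverts G. SUP v\<in>pverts G. wf_digraph.\<mu> (with_proj G) (\<lambda>_. 1) u v)"

definition pendant :: "'a pair_pre_digraph \<Rightarrow> 'a \<Rightarrow> bool" where
  "pendant G v \<longleftrightarrow> v \<in> pverts G \<and> out_degree (with_proj G) v = 1"

definition F_degree :: "'a pair_pre_digraph \<Rightarrow> 'b pair_pre_digraph \<Rightarrow> 'b \<Rightarrow> nat" where
  "F_degree F G v =
    card {H. pair_graph H \<and> subgraph (with_proj H) (with_proj G)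
      \<and> digraph_iso (with_proj F) (with_proj H) \<and> v \<in> pverts H}"

definition F_irregular :: "'a pair_pre_digraph \<Rightarrow> 'b pair_pre_digraph \<Rightarrow> bool" where
  "F_irregular F G \<longleftrightarrow> inj_on (F_degree F G) (pverts G)"

end

theory Submission
  imports Defs
begin

text \<open>
  Instead of copies of \<open>F\<close> one may count embeddings of \<open>F\<close>, since both counts differ by the factor
  \<open>|Aut F|\<close>. The graphs consist of two cliques \<open>a\<^sub>0, \<dots>, a\<^sub>m\<close> and \<open>c\<^sub>0, \<dots>, c\<^sub>m\<close>, with \<open>a\<^sub>i\<close> and \<open>c\<^sub>k\<close>
  adjacent iff \<open>i + k > m\<close>, and one extra vertex \<open>d\<close> joined to \<open>a\<^sub>0, \<dots>, a\<^bsub>\<delta>-1\<^esub>\<close>, where \<open>\<delta>\<close> is the minimum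
  degree of \<open>F\<close>; here \<open>2 \<le> \<delta> \<le> n - 2\<close>, as \<open>F\<close> has no pendant vertex and is not complete.

  Without \<open>d\<close>, the number of embeddings through \<open>a\<^sub>i\<close> equals that through \<open>c\<^sub>i\<close>, and it grows with \<open>i\<close> in
  steps of order \<open>m\<^bsup>n-2\<^esup>\<close>, because \<open>a\<^bsub>i+1\<^esub>\<close> has one more neighbour than \<open>a\<^sub>i\<close>. An embedding through \<open>d\<close>
  must put a vertex of degree \<open>\<delta>\<close> on \<open>d\<close> and its neighbours on those of \<open>d\<close>, so there are only
  \<open>O(m\<^bsup>n-3\<^esup>)\<close> of them. For large \<open>m\<close> it thus remains to distinguish \<open>a\<^sub>i\<close> from \<open>c\<^sub>i\<close> by the embeddings
  through \<open>d\<close>. Exchanging \<open>a\<^sub>k\<close> with \<open>c\<^sub>k\<close> on a suitable part of \<open>F\<close> turns those through \<open>c\<^sub>i\<close>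
  injectively into embeddings through \<open>a\<^sub>i\<close>, apart from a lower-order number of embeddings that use
  both \<open>a\<^sub>k\<close> and \<open>c\<^sub>k\<close> for some \<open>k\<close>, and it misses a positive proportion of the embeddings through
  \<open>a\<^sub>i\<close>.
\<close>

section \<open>Copies and embeddings\<close>

definition image_graph :: "('a \<Rightarrow> 'b) \<Rightarrow> 'a pair_pre_digraph \<Rightarrow> 'b pair_pre_digraph" where
  "image_graph f F = \<lparr>pverts = f ` pverts F, parcs = map_prod f f ` parcs F\<rparr>"

lemma image_graph_simps [simp]:
  "pverts (image_graph f F) = f ` pverts F"
  "parcs (image_graph f F) = map_prod f f ` parcs F"
  by (simp_all add: image_graph_def)

lemma image_graph_cong:
  assumes "pair_wf_digraph F" "\<And>x. x \<in> pverts F \<Longrightarrow> f x = g x"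
  shows "image_graph f F = image_graph g F"
proof -
  interpret pair_wf_digraph F by fact
  have "map_prod f f e = map_prod g g e" if "e \<in> parcs F" for e
    using that assms(2) arc_fst_in_verts arc_snd_in_verts by (cases e) force
  then show ?thesis using assms(2) by (auto simp: image_graph_def intro!: image_cong)
qed

lemma (in pair_wf_digraph) inj_on_map_prod_parcs:
  assumes "inj_on f (pverts G)"
  shows "inj_on (map_prod f f) (parcs G)"
proof -
  have "inj_on (map_prod f f) (pverts G \<times> pverts G)"
    using assms by (simp add: map_prod_inj_on)
  then show ?thesis
    by (rule inj_on_subset) (use arc_fst_in_verts arc_snd_in_verts in force)
qed

text \<open>Tail and head are \<open>fst\<close> and \<open>snd\<close> on both sides, so the arc
  map of an isomorphism is forced by its vertex map.\<close>

lemma digraph_iso_iff_image_graph: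
  assumes "pair_wf_digraph F"
  shows "digraph_iso (with_proj F) (with_proj H)
    \<longleftrightarrow> (\<exists>f. inj_on f (pverts F) \<and> H = image_graph f F)"
proof -
  interpret F: pair_wf_digraph F by fact
  have wf: "wf_digraph (with_proj F)" by unfold_locales
  show ?thesis
  proof
    assume "digraph_iso (with_proj F) (with_proj H)"
    then obtain h where h: "F.digraph_isomorphism h" "with_proj H = app_iso h (with_proj F)"
      by (auto simp: digraph_iso_def)
    have eqs: "pverts H = iso_verts h ` pverts F" "parcs H = iso_arcs h ` parcs F"
      "fst = iso_tail h" "snd = iso_head h"
      using h(2) by (auto simp: with_proj_def app_iso_def)
    have "iso_arcs h e = map_prod (iso_verts h) (iso_verts h) e" if "e \<in> parcs F" for e
      using h(1) that eqs(3,4)[symmetric]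
      by (cases e) (force simp: F.digraph_isomorphism_def prod_eq_iff)
    then have "H = image_graph (iso_verts h) F"
      using eqs by (intro pair_pre_digraph.equality) (auto intro!: image_cong)
    moreover have "inj_on (iso_verts h) (pverts F)"
      using h(1) by (simp add: F.digraph_isomorphism_def)
    ultimately show "\<exists>f. inj_on f (pverts F) \<and> H = image_graph f F" by blast
  next
    assume "\<exists>f. inj_on f (pverts F) \<and> H = image_graph f F"
    then obtain f where f: "inj_on f (pverts F)" "H = image_graph f F" by blast
    let ?h = "\<lparr>iso_verts = f, iso_arcs = map_prod f f, iso_head = snd, iso_tail = fst\<rparr>"
    have "inj_on (map_prod f f) (parcs F)"
      using F.inj_on_map_prod_parcs[OF f(1)] .
    then have "F.digraph_isomorphism ?h"
      using f(1) wf by (simp add: F.digraph_isomorphism_def)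
    moreover have "with_proj H = app_iso ?h (with_proj F)"
      using f(2) by (simp add: app_iso_def with_proj_def)
    ultimately show "digraph_iso (with_proj F) (with_proj H)"
      unfolding digraph_iso_def by blast
  qed
qed

lemma pair_graph_image_graph:
  assumes "pair_graph F" "inj_on f (pverts F)"
  shows "pair_graph (image_graph f F)"
proof -
  interpret F: pair_graph F by fact
  show ?thesis
  proof
    show "symmetric (with_proj (image_graph f F))"
      using F.pair_sym_arcs by (auto simp: symmetric_def sym_def)
    show "fst e \<noteq> snd e" if "e \<in> parcs (image_graph f F)" for e
      using that inj_onD[OF assms(2)] F.no_loops' F.in_arcsD1 F.in_arcsD2 by force
  qed (use F.in_arcsD1 F.in_arcsD2 F.pair_finite_verts F.pair_finite_arcs in auto)
qed

text \<open>Extensionality outside \<open>pverts F\<close> makes sure that each injective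
  homomorphism is counted exactly once.\<close>

definition embeddings :: "'a pair_pre_digraph \<Rightarrow> 'b pair_pre_digraph \<Rightarrow> ('a \<Rightarrow> 'b) set" where
  "embeddings F G = {f \<in> pverts F \<rightarrow>\<^sub>E pverts G.
     inj_on f (pverts F) \<and> (\<forall>(u, v) \<in> parcs F. (f u, f v) \<in> parcs G)}"

lemma embeddingsI:
  assumes "f \<in> extensional (pverts F)" "\<And>x. x \<in> pverts F \<Longrightarrow> f x \<in> pverts G"
    "inj_on f (pverts F)" "\<And>x y. (x, y) \<in> parcs F \<Longrightarrow> (f x, f y) \<in> parcs G"
  shows "f \<in> embeddings F G"
  using assms by (auto simp: embeddings_def PiE_def)

lemma embeddingsD:
  assumes "f \<in> embeddings F G"
  shows "f \<in> extensional (pverts F)" "inj_on f (pverts F)"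
    and "\<And>x. x \<in> pverts F \<Longrightarrow> f x \<in> pverts G"
    and "\<And>x y. (x, y) \<in> parcs F \<Longrightarrow> (f x, f y) \<in> parcs G"
  using assms by (auto simp: embeddings_def PiE_def)

lemma finite_embeddings:
  assumes "finite (pverts F)" "finite (pverts G)"
  shows "finite (embeddings F G)"
  by (rule finite_subset[OF _ finite_PiE[OF assms(1), of "\<lambda>_. pverts G"]])
    (use assms(2) in \<open>auto simp: embeddings_def\<close>)

lemma F_degree_set_eq:
  assumes "pair_graph F" "pair_graph G"
  shows "{H. pair_graph H \<and> subgraph (with_proj H) (with_proj G)
      \<and> digraph_iso (with_proj F) (with_proj H) \<and> v \<in> pverts H}
    = (\<lambda>f. image_graph f F) ` {f \<in> embeddings F G. v \<in> f ` pverts F}" (is "?L = ?R")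
proof -
  interpret F: pair_graph F by fact
  interpret G: pair_graph G by fact
  have wf: "pair_wf_digraph F" by unfold_locales
  show ?thesis
  proof (intro set_eqI iffI)
    fix H assume "H \<in> ?L"
    then have H: "pair_graph H" "subgraph (with_proj H) (with_proj G)" "v \<in> pverts H"
      and "digraph_iso (with_proj F) (with_proj H)" by auto
    then obtain f where f: "inj_on f (pverts F)" "H = image_graph f F"
      using digraph_iso_iff_image_graph[OF wf] by blast
    let ?f = "restrict f (pverts F)"
    have eq: "H = image_graph ?f F"
      using f(2) image_graph_cong[OF wf, of f ?f] by simp
    have "pverts H \<subseteq> pverts G" "parcs H \<subseteq> parcs G"
      using H(2) by (auto simp: subgraph_def)
    then have "?f \<in> embeddings F G"
      using f F.in_arcsD1 F.in_arcsD2 by (auto simp: embeddings_def inj_on_def image_subset_iff)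
    moreover have "v \<in> ?f ` pverts F" using H(3) f(2) by auto
    ultimately show "H \<in> ?R" using eq by blast
  next
    fix H assume "H \<in> ?R"
    then obtain f where f: "f \<in> embeddings F G" "v \<in> f ` pverts F" "H = image_graph f F" by blast
    have inj: "inj_on f (pverts F)" using f(1) by (simp add: embeddings_def)
    interpret H: pair_graph H using pair_graph_image_graph[OF assms(1) inj] f(3) by simp
    have "pverts H \<subseteq> pverts G" "parcs H \<subseteq> parcs G"
      using f by (auto simp: embeddings_def)
    then have "subgraph (with_proj H) (with_proj G)"
      using G.wf_digraph_axioms H.wf_digraph_axioms by (simp add: subgraph_def compatible_def)
    then show "H \<in> ?L"
      using f(2,3) inj digraph_iso_iff_image_graph[OF wf] H.pair_graph by auto
  qed
qed

text \<open>Group the embeddings by their image. Each fibre arises from any one of its members by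
  precomposition with the elements of \<open>embeddings F F\<close>, which by finiteness are the
  automorphisms of \<open>F\<close>.\<close>

lemma card_embeddings_through:
  assumes "pair_graph F" "pair_graph G"
  shows "card {f \<in> embeddings F G. v \<in> f ` pverts F} = F_degree F G v * card (embeddings F F)"
proof -
  interpret F: pair_graph F by fact
  interpret G: pair_graph G by fact
  have wf: "pair_wf_digraph F" by unfold_locales
  let ?V = "pverts F"
  let ?E = "{f \<in> embeddings F G. v \<in> f ` ?V}"
  let ?im = "\<lambda>f. image_graph f F"
  let ?fib = "\<lambda>H. {f \<in> ?E. ?im f = H}"
  have finE: "finite ?E"
    using finite_embeddings[OF F.pair_finite_verts G.pair_finite_verts] by simp
  have fib: "card (?fib H) = card (embeddings F F)" if HE: "H \<in> ?im ` ?E" for H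
  proof -
    obtain g where g: "g \<in> ?E" "H = ?im g" by (rule imageE[OF HE])
    have gi: "inj_on g ?V" and gG: "g ` ?V \<subseteq> pverts G" "\<And>x y. (x, y) \<in> parcs F \<Longrightarrow> (g x, g y) \<in> parcs G"
      using g(1) by (auto simp: embeddings_def)
    have "bij_betw (compose ?V g) (embeddings F F) (?fib H)"
    proof (rule bij_betw_imageI)
      show "inj_on (compose ?V g) (embeddings F F)"
      proof (rule inj_onI, rule ext)
        fix f f' x assume ff: "f \<in> embeddings F F" "f' \<in> embeddings F F"
          and eq: "compose ?V g f = compose ?V g f'"
        show "f x = f' x"
        proof (cases "x \<in> ?V")
          case True
          then have "g (f x) = g (f' x)" using fun_cong[OF eq, of x] by (simp add: compose_def)
          moreover have "f x \<in> ?V" "f' x \<in> ?V" using ff True by (auto simp: embeddings_def)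
          ultimately show ?thesis using gi by (auto simp: inj_on_def)
        next
          case False
          then show ?thesis using ff by (auto simp: embeddings_def PiE_def extensional_def)
        qed
      qed
      show "compose ?V g ` embeddings F F = ?fib H"
      proof (intro set_eqI iffI)
        fix k assume "k \<in> compose ?V g ` embeddings F F"
        then obtain f where f: "f \<in> embeddings F F" and k: "k = compose ?V g f" by blast
        have fi: "inj_on f ?V" and fV: "f ` ?V \<subseteq> ?V"
          and fA: "\<And>x y. (x, y) \<in> parcs F \<Longrightarrow> (f x, f y) \<in> parcs F"
          using f by (auto simp: embeddings_def)
        \<comment> \<open>Finiteness turns the injective self-map into an automorphism, on vertices
          here and on arcs below.\<close>
        have onto: "f ` ?V = ?V" using endo_inj_surj[OF F.pair_finite_verts fV fi] .
        have "inj_on (map_prod f f) (parcs F)"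
          using F.inj_on_map_prod_parcs[OF fi] .
        moreover have "map_prod f f ` parcs F \<subseteq> parcs F" using fA by auto
        ultimately have ontoA: "map_prod f f ` parcs F = parcs F"
          using endo_inj_surj[OF F.pair_finite_arcs] by blast
        have ke: "k x = g (f x)" if "x \<in> ?V" for x using that k by (simp add: compose_def)
        have "?im k = ?im (g \<circ> f)" using image_graph_cong[OF wf, of k "g \<circ> f"] ke by simp
        also have "\<dots> = ?im g"
        proof -
          have "(g \<circ> f) ` ?V = g ` ?V" by (simp only: image_comp[symmetric] onto)
          moreover have "map_prod (g \<circ> f) (g \<circ> f) ` parcs F = map_prod g g ` parcs F"
            by (simp only: map_prod.comp[symmetric] image_comp[symmetric] ontoA)
          ultimately show ?thesis by (simp add: image_graph_def)
        qed
        finally have imk: "?im k = H" using g(2) by simp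
        have kV: "k ` ?V = g ` ?V" using imk g(2)
          by (metis image_graph_simps(1))
        have "inj_on (g \<circ> f) ?V" using fi gi onto by (simp add: comp_inj_on)
        then have "inj_on k ?V" using ke by (auto simp: inj_on_def)
        moreover have "k \<in> ?V \<rightarrow>\<^sub>E pverts G"
          using k kV gG(1) by (auto simp: compose_def)
        moreover have "(k x, k y) \<in> parcs G" if "(x, y) \<in> parcs F" for x y
          using ke[OF F.in_arcsD1[OF that]] ke[OF F.in_arcsD2[OF that]] gG(2)[OF fA[OF that]] by simp
        ultimately have "k \<in> embeddings F G" by (auto simp: embeddings_def)
        then show "k \<in> ?fib H" using imk kV g(1) by simp
      next
        fix k assume "k \<in> ?fib H"
        then have kE: "k \<in> embeddings F G" and imk: "?im k = ?im g" using g(2) by auto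
        have kV: "k ` ?V = g ` ?V" and kA: "map_prod k k ` parcs F = map_prod g g ` parcs F"
          using imk by (metis image_graph_simps)+
        let ?i = "inv_into ?V g"
        \<comment> \<open>Two embeddings with the same image differ by this automorphism: apply
          \<open>k\<close>, then undo \<open>g\<close>.\<close>
        let ?f = "restrict (\<lambda>x. ?i (k x)) ?V"
        have gf: "g (?f x) = k x" if "x \<in> ?V" for x
        proof -
          have "k x \<in> g ` ?V" using that kV by blast
          then show ?thesis using that by (simp add: f_inv_into_f)
        qed
        have fV: "?f x \<in> ?V" if "x \<in> ?V" for x
        proof -
          have "k x \<in> g ` ?V" using that kV by blast
          then show ?thesis using that by (simp add: inv_into_into)
        qed
        have ki: "inj_on k ?V" using kE by (simp add: embeddings_def)
        have "inj_on ?f ?V"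
        proof (rule inj_onI)
          fix x y assume xy: "x \<in> ?V" "y \<in> ?V" "?f x = ?f y"
          have "k x = k y" using gf[OF xy(1)] gf[OF xy(2)] xy(3) by simp
          then show "x = y" using inj_onD[OF ki] xy(1,2) by blast
        qed
        moreover have "(?f x, ?f y) \<in> parcs F" if xy: "(x, y) \<in> parcs F" for x y
        proof -
          have xV: "x \<in> ?V" "y \<in> ?V" using xy F.in_arcsD1 F.in_arcsD2 by auto
          have "(k x, k y) \<in> map_prod g g ` parcs F" using kA xy by force
          then obtain a b where ab: "(a, b) \<in> parcs F" "k x = g a" "k y = g b" by auto
          then have "?f x = a" "?f y = b"
            using xV F.in_arcsD1[OF ab(1)] F.in_arcsD2[OF ab(1)] gi by (simp_all add: inv_into_f_f)
          then show ?thesis using ab(1) by simp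
        qed
        ultimately have fE: "?f \<in> embeddings F F" using fV by (intro embeddingsI) blast+
        have "k = compose ?V g ?f"
        proof
          fix x show "k x = compose ?V g ?f x"
            using gf[of x] kE by (cases "x \<in> ?V") (auto simp: compose_def embeddings_def PiE_def extensional_def)
        qed
        then show "k \<in> compose ?V g ` embeddings F F"
          using fE by (rule image_eqI[where f = "compose ?V g"])
      qed
    qed
    then show ?thesis by (simp add: bij_betw_same_card)
  qed
  have "card ?E = (\<Sum>H\<in>?im ` ?E. card (?fib H))"
    using sum.image_gen[OF finE, of "\<lambda>_. 1 :: nat" ?im] by simp
  also have "\<dots> = card (?im ` ?E) * card (embeddings F F)" using fib by simp
  finally show ?thesis by (simp add: F_degree_def F_degree_set_eq[OF assms])
qed

lemma F_irregularI:
  assumes "pair_graph F" "pair_graph G"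
    and "inj_on (\<lambda>v. card {f \<in> embeddings F G. v \<in> f ` pverts F}) (pverts G)"
  shows "F_irregular F G"
  using assms(3) by (auto simp: F_irregular_def inj_on_def card_embeddings_through[OF assms(1,2)])

section \<open>Counting functions\<close>

text \<open>Lower-bound tool: with \<open>P\<close> placed as \<open>g\<close> prescribes, the other
  vertices go injectively anywhere into \<open>K\<close>. Every factor of the resulting falling
  factorial is at least \<open>card K - card (V - P)\<close>.\<close>

lemma card_ge_inj_extensions:
  assumes "finite V" "finite K" "finite T" "P \<subseteq> V"
    and T: "\<And>f. f \<in> extensional V \<Longrightarrow> (\<And>p. p \<in> P \<Longrightarrow> f p = g p) \<Longrightarrow> f ` (V - P) \<subseteq> K
      \<Longrightarrow> inj_on f (V - P) \<Longrightarrow> f \<in> T"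
  shows "(card K - card (V - P)) ^ card (V - P) \<le> card T"
proof -
  let ?D = "V - P"
  let ?S = "{h \<in> ?D \<rightarrow>\<^sub>E K. inj_on h ?D}"
  let ?ext = "\<lambda>h. restrict (\<lambda>x. if x \<in> P then g x else h x) V"
  have finD: "finite ?D" using assms(1) by simp
  have "(card K - card ?D) ^ card ?D = (\<Prod>i\<in>{0..<card ?D}. card K - card ?D)" by simp
  also have "\<dots> \<le> prod ((-) (card K)) {0..<card ?D}" by (rule prod_mono) auto
  also have "\<dots> = card ?S"
    using card_inj_on_subset_funcset[OF finD assms(2), of ?D] by simp
  also have "\<dots> \<le> card T"
  proof (rule card_inj_on_le)
    show "inj_on ?ext ?S"
    proof (rule inj_onI, rule ext)
      fix h h' x assume h: "h \<in> ?S" "h' \<in> ?S" and eq: "?ext h = ?ext h'"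
      show "h x = h' x"
      proof (cases "x \<in> ?D")
        case True
        then show ?thesis using fun_cong[OF eq, of x] by simp
      next
        case False
        then show ?thesis using h by (auto simp: PiE_def extensional_def)
      qed
    qed
    show "?ext ` ?S \<subseteq> T"
    proof
      fix f assume "f \<in> ?ext ` ?S"
      then obtain h where h: "h \<in> ?S" "f = ?ext h" by blast
      have fh: "f x = h x" if "x \<in> ?D" for x using h(2) that by simp
      show "f \<in> T"
      proof (rule T)
        show "f p = g p" if "p \<in> P" for p using h(2) that assms(4) by auto
        show "f ` ?D \<subseteq> K" using h(1) fh by auto
        have "inj_on h ?D" using h(1) by simp
        then show "inj_on f ?D" using fh by (simp add: inj_on_def)
      qed (simp add: h(2))
    qed
  qed fact
  finally show ?thesis .
qed

text \<open>Upper-bound tool for \<open>PiE\<close>: vertices in \<open>U\<close> are forced, those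
  in \<open>N\<close> have few options, and the others may range over the whole host.\<close>

lemma prod_card_le:
  fixes c :: "'a \<Rightarrow> nat"
  assumes "finite S" "N \<subseteq> S" "U \<subseteq> S" "N \<inter> U = {}"
    and "\<And>w. w \<in> U \<Longrightarrow> c w \<le> 1" "\<And>w. w \<in> N \<Longrightarrow> c w \<le> a" "\<And>w. w \<in> S \<Longrightarrow> c w \<le> b"
  shows "prod c S \<le> a ^ card N * b ^ (card S - card N - card U)"
proof -
  let ?R = "S - N - U"
  have fin: "finite N" "finite U" using assms(1-3) finite_subset by auto
  have "prod c S = prod c N * (prod c U * prod c ?R)"
    using prod.subset_diff[OF assms(2,1), of c] prod.subset_diff[of U "S - N" c] assms(1,3,4)
    by (auto simp: mult.commute)
  also have "\<dots> \<le> a ^ card N * (1 ^ card U * b ^ card ?R)"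
    using assms(2,5-7) prod_mono[of N c "\<lambda>_. a"] prod_mono[of U c "\<lambda>_. 1"] prod_mono[of ?R c "\<lambda>_. b"]
    by (intro mult_mono) auto
  also have "card ?R = card S - card N - card U"
  proof -
    have "U \<subseteq> S - N" using assms(3,4) by auto
    then show ?thesis using card_Diff_subset[OF fin(1) assms(2)] card_Diff_subset[OF fin(2)] by simp
  qed
  finally show ?thesis by simp
qed

text \<open>With \<open>5 * B\<close> bounding the order of the host, the left side bounds a count
  with \<open>k\<close> free vertices; it loses against one more factor \<open>B\<close>.\<close>

lemma power_dominates:
  fixes B K k n :: nat
  assumes "K * 5 ^ n < B" "k \<le> n"
  shows "K * (5 * B) ^ k < B ^ Suc k"
proof -
  have "K * 5 ^ k \<le> K * 5 ^ n" using assms(2) by (simp add: power_increasing)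
  then have "K * 5 ^ k < B" using assms(1) by linarith
  then have "(K * 5 ^ k) * B ^ k < B * B ^ k" by (intro mult_strict_right_mono) auto
  then show ?thesis by (simp add: power_mult_distrib mult.assoc)
qed

section \<open>The host graphs\<close>

text \<open>The vertices \<open>a\<^sub>i\<close>, \<open>c\<^sub>i\<close> and \<open>d\<close> are encoded as \<open>2 i\<close>, \<open>2 i + 1\<close> and \<open>2 m + 2\<close>, respectively.\<close>

definition core_adj :: "nat \<Rightarrow> nat \<Rightarrow> nat \<Rightarrow> bool" where
  "core_adj m x y \<longleftrightarrow> x \<le> 2 * m + 1 \<and> y \<le> 2 * m + 1 \<and> x \<noteq> y
    \<and> (even x = even y \<or> m < x div 2 + y div 2)"

definition host :: "nat \<Rightarrow> nat \<Rightarrow> nat pair_pre_digraph" where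
  "host \<delta> m = \<lparr>pverts = {..2 * m + 2},
     parcs = {(x, y). core_adj m x y
       \<or> x = 2 * m + 2 \<and> even y \<and> y < 2 * \<delta> \<or> y = 2 * m + 2 \<and> even x \<and> x < 2 * \<delta>}\<rparr>"

lemma core_adj_sym: "core_adj m x y \<longleftrightarrow> core_adj m y x"
  by (auto simp: core_adj_def add.commute)

lemma pverts_host [simp]: "pverts (host \<delta> m) = {..2 * m + 2}"
  by (simp add: host_def)

lemma parcs_host_iff:
  "(x, y) \<in> parcs (host \<delta> m) \<longleftrightarrow> core_adj m x y
    \<or> x = 2 * m + 2 \<and> even y \<and> y < 2 * \<delta> \<or> y = 2 * m + 2 \<and> even x \<and> x < 2 * \<delta>"
  by (simp add: host_def)

lemma parcs_host_core:
  assumes "x \<noteq> 2 * m + 2" "y \<noteq> 2 * m + 2"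
  shows "(x, y) \<in> parcs (host \<delta> m) \<longleftrightarrow> core_adj m x y"
  using assms by (simp add: parcs_host_iff)

lemma pair_graph_host:
  assumes "\<delta> \<le> m + 1"
  shows "pair_graph (host \<delta> m)"
proof
  have sub: "parcs (host \<delta> m) \<subseteq> {..2 * m + 2} \<times> {..2 * m + 2}"
    using assms by (auto simp: host_def core_adj_def)
  then show "finite (parcs (host \<delta> m))" by (rule finite_subset) simp
  show "fst e \<in> pverts (host \<delta> m)" "snd e \<in> pverts (host \<delta> m)" if "e \<in> parcs (host \<delta> m)" for e
    using that sub by auto
  show "symmetric (with_proj (host \<delta> m))"
    by (auto simp: symmetric_def sym_def parcs_host_iff core_adj_sym)
  show "fst e \<noteq> snd e" if "e \<in> parcs (host \<delta> m)" for e
    using that assms by (cases e) (auto simp: parcs_host_iff core_adj_def)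
qed simp

text \<open>The involution exchanging \<open>a\<^sub>i\<close> and \<open>c\<^sub>i\<close>. The
  partner of \<open>d\<close> would be \<open>2 * m + 3\<close>, which is not a vertex.\<close>

definition flip :: "nat \<Rightarrow> nat" where
  "flip x = (if even x then x + 1 else x - 1)"

lemma flip_flip [simp]: "flip (flip x) = x"
  and flip_div2 [simp]: "flip x div 2 = x div 2"
  and even_flip [simp]: "even (flip x) \<longleftrightarrow> odd x"
  and flip_neq [simp]: "flip x \<noteq> x" "x \<noteq> flip x"
  by (auto simp: flip_def elim!: oddE evenE)

lemma flip_double [simp]: "flip (2 * i) = 2 * i + 1" "flip (Suc (2 * i)) = 2 * i"
  by (auto simp: flip_def)

lemma div2_eqD:
  fixes x y :: nat
  assumes "x div 2 = y div 2" "x \<noteq> y"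
  shows "y = flip x"
  using assms by (auto simp: flip_def elim!: oddE evenE)

lemma inj_flip: "inj flip"
  by (metis flip_flip injI)

lemma flip_le_iff [simp]: "flip x \<le> 2 * m + 1 \<longleftrightarrow> x \<le> 2 * m + 1"
  by (auto simp: flip_def elim!: oddE evenE)

lemma core_adj_flip [simp]: "core_adj m (flip x) (flip y) \<longleftrightarrow> core_adj m x y"
proof -
  have "flip x = flip y \<longleftrightarrow> x = y" using inj_flip by (auto simp: inj_def)
  then show ?thesis by (auto simp: core_adj_def simp del: One_nat_def add_Suc_right add_0_right)
qed

lemma core_adj_parity:
  assumes "core_adj m x y" "x div 2 + y div 2 \<le> m"
  shows "even x = even y"
  using assms by (auto simp: core_adj_def)

text \<open>\<open>B\<close> is the scale that will tend to infinity. \<open>leave_nbrs\<close>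
  provides, for each \<open>p\<close> that can be placed on \<open>d\<close>, a path from
  \<open>p\<close> through a neighbour \<open>z\<close> to a vertex \<open>u\<close> at distance
  two; it is the source of the anchored embeddings.\<close>

locale host_setup = F: pair_graph F for F :: "'a pair_pre_digraph" +
  fixes n \<delta> B :: nat
  assumes card_verts: "card (pverts F) = n"
    and \<delta>_ge: "2 \<le> \<delta>" and \<delta>_le: "\<delta> + 2 \<le> n"
    and min_degree: "\<And>p. p \<in> pverts F \<Longrightarrow> \<delta> \<le> card {q. (p, q) \<in> parcs F}"
    and min_degree_attained: "\<exists>p\<in>pverts F. card {q. (p, q) \<in> parcs F} = \<delta>"
    and leave_nbrs: "\<And>p. \<lbrakk>p \<in> pverts F; card {q. (p, q) \<in> parcs F} = \<delta>\<rbrakk> \<Longrightarrow>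
      \<exists>z u. (p, z) \<in> parcs F \<and> u \<in> pverts F \<and> u \<noteq> p \<and> (p, u) \<notin> parcs F \<and> (u, z) \<in> parcs F"
    and B_ge: "4 * n + 7 \<le> B" and B_dominates: "n ^ (n + 4) * 5 ^ n < B"
begin

abbreviation "V \<equiv> pverts F"

definition "nbrs p = {q. (p, q) \<in> parcs F}"

text \<open>Half of \<open>m\<close> still exceeds \<open>B + n\<close>, which leaves
  \<open>B\<close> choices per free vertex in the cliques used below, while \<open>B_ge\<close>
  gives \<open>2 * m + 3 \<le> 5 * B\<close>.\<close>

definition "m = 2 * B + 2 * n + 2"

abbreviation "G \<equiv> host \<delta> m"

definition "d = 2 * m + 2"

definition "D = {x. even x \<and> x < 2 * \<delta>}"

definition "through x = {f \<in> embeddings F G. d \<in> f ` V \<and> x \<in> f ` V}"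

definition "core_through x = {f \<in> embeddings F G. d \<notin> f ` V \<and> x \<in> f ` V}"

lemma m_ge: "\<delta> + n + B \<le> m" "n \<le> m" "\<delta> \<le> m" "1 \<le> m"
  using \<delta>_le by (simp_all add: m_def)

section \<open>Basic facts about \<open>F\<close>, the neighbours of \<open>d\<close>, and
  embeddings into the core\<close>

lemma finite_V [simp]: "finite V"
  by (rule F.pair_finite_verts)

lemma finite_embeddings_G [simp]: "finite (embeddings F G)"
  by (rule finite_embeddings) simp_all

lemma finite_through [simp]: "finite (through x)" "finite (core_through x)"
  by (simp_all add: through_def core_through_def)

lemma nbrs_subset: "nbrs p \<subseteq> V"
  using F.in_arcsD2 by (auto simp: nbrs_def)

lemma finite_nbrs [simp]: "finite (nbrs p)"
  using nbrs_subset finite_V by (rule finite_subset)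

lemma self_notin_nbrs [simp]: "p \<notin> nbrs p"
  using F.no_loops' by (auto simp: nbrs_def)

lemma parcs_sym: "(x, y) \<in> parcs F \<Longrightarrow> (y, x) \<in> parcs F"
  using F.pair_sym_arcs by (auto simp: symmetric_def sym_def)

lemma D_eq: "D = (*) 2 ` {..<\<delta>}"
  by (auto simp: D_def elim!: evenE)

lemma card_D: "card D = \<delta>"
  by (simp add: D_eq card_image inj_on_def)

lemma finite_D [simp]: "finite D"
  by (simp add: D_eq)

lemma d_neq: "x \<in> D \<Longrightarrow> x \<noteq> d" "x \<le> 2 * m + 1 \<Longrightarrow> x \<noteq> d"
  using m_ge(3) by (auto simp: D_def d_def)

lemma parcs_G_d: "(d, x) \<in> parcs G \<longleftrightarrow> x \<in> D" "(x, d) \<in> parcs G \<longleftrightarrow> x \<in> D"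
  using m_ge(3) by (auto simp: parcs_host_iff d_def D_def core_adj_def)

lemma parcs_G_core: "x \<noteq> d \<Longrightarrow> y \<noteq> d \<Longrightarrow> (x, y) \<in> parcs G \<longleftrightarrow> core_adj m x y"
  by (simp add: d_def parcs_host_core)

lemma verts_G: "x \<in> pverts G \<Longrightarrow> x \<noteq> d \<Longrightarrow> x \<le> 2 * m + 1"
  by (auto simp: d_def)

lemma core_embeddingD:
  assumes "f \<in> core_through x"
  shows "f \<in> extensional V" "inj_on f V" "x \<in> f ` V"
    and "\<And>w. w \<in> V \<Longrightarrow> f w \<le> 2 * m + 1"
    and "\<And>u v. (u, v) \<in> parcs F \<Longrightarrow> core_adj m (f u) (f v)"
proof -
  have f: "f \<in> embeddings F G" and nd: "d \<notin> f ` V" using assms by (auto simp: core_through_def)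
  have ne: "f w \<noteq> d" if "w \<in> V" for w using that nd by (metis imageI)
  show "f \<in> extensional V" "inj_on f V" using embeddingsD[OF f] by auto
  show "x \<in> f ` V" using assms by (simp add: core_through_def)
  show "f w \<le> 2 * m + 1" if "w \<in> V" for w
    using verts_G[OF embeddingsD(3)[OF f that] ne[OF that]] .
  show "core_adj m (f u) (f v)" if "(u, v) \<in> parcs F" for u v
    using embeddingsD(4)[OF f that] parcs_G_core[OF ne[OF F.in_arcsD1[OF that]] ne[OF F.in_arcsD2[OF that]]]
    by simp
qed

lemma core_throughI:
  assumes "f \<in> extensional V" "inj_on f V" "x \<in> f ` V"
    and "\<And>w. w \<in> V \<Longrightarrow> f w \<le> 2 * m + 1"
    and adj: "\<And>u v. (u, v) \<in> parcs F \<Longrightarrow> core_adj m (f u) (f v)"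
  shows "f \<in> core_through x"
proof -
  have ne: "f w \<noteq> d" if "w \<in> V" for w using assms(4)[OF that] d_neq by blast
  have "f \<in> embeddings F G"
  proof (rule embeddingsI)
    show "f w \<in> pverts G" if "w \<in> V" for w using assms(4)[OF that] by simp
    show "(f u, f v) \<in> parcs G" if "(u, v) \<in> parcs F" for u v
      using adj[OF that] by (simp add: parcs_host_iff)
  qed fact+
  moreover have "d \<notin> f ` V" using ne by force
  ultimately show ?thesis using assms(3) by (simp add: core_through_def)
qed

text \<open>Injections into a clique are embeddings whatever \<open>F\<close> looks like; the lower
  bounds for embeddings avoiding \<open>d\<close> rest on this.\<close>

lemma clique_core_through:
  assumes "f \<in> extensional V" "inj_on f V" "f ` V \<subseteq> Q" "x \<in> f ` V"
    and Q: "\<And>x y. x \<in> Q \<Longrightarrow> y \<in> Q \<Longrightarrow> x \<noteq> y \<Longrightarrow> core_adj m x y" "\<And>x. x \<in> Q \<Longrightarrow> x \<le> 2 * m + 1"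
  shows "f \<in> core_through x"
proof (rule core_throughI)
  show "f w \<le> 2 * m + 1" if "w \<in> V" for w using that assms(3) Q(2) by blast
  show "core_adj m (f u) (f v)" if uv: "(u, v) \<in> parcs F" for u v
  proof (rule Q(1))
    have "u \<in> V" "v \<in> V" "u \<noteq> v" using uv F.in_arcsD1 F.in_arcsD2 F.no_loops' by auto
    then show "f u \<in> Q" "f v \<in> Q" "f u \<noteq> f v" using assms(2,3) by (auto simp: inj_on_def)
  qed
qed fact+

text \<open>\<open>flip\<close> is an automorphism of the host without \<open>d\<close>, so
  composing with it is injective on embeddings.\<close>

lemma card_core_through_flip_le: "card (core_through x) \<le> card (core_through (flip x))"
proof (rule card_inj_on_le)
  let ?\<Phi> = "\<lambda>f. restrict (flip \<circ> f) V"
  show "inj_on ?\<Phi> (core_through x)"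
  proof (rule inj_onI, rule extensionalityI)
    fix f g assume fg: "f \<in> core_through x" "g \<in> core_through x" "?\<Phi> f = ?\<Phi> g"
    show "f \<in> extensional V" "g \<in> extensional V" using fg core_embeddingD(1) by auto
    show "f w = g w" if "w \<in> V" for w
      using fun_cong[OF fg(3), of w] that inj_flip by (simp add: inj_eq)
  qed
  show "?\<Phi> ` core_through x \<subseteq> core_through (flip x)"
  proof clarify
    fix f assume "f \<in> core_through x"
    note f = core_embeddingD[OF this]
    show "?\<Phi> f \<in> core_through (flip x)"
    proof (rule core_throughI)
      show "inj_on (?\<Phi> f) V" using f(2) inj_flip by (auto simp: inj_on_def inj_def)
      show "flip x \<in> ?\<Phi> f ` V" using f(3) by auto
      show "core_adj m (?\<Phi> f u) (?\<Phi> f v)" if "(u, v) \<in> parcs F" for u v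
        using f(5)[OF that] F.in_arcsD1[OF that] F.in_arcsD2[OF that] by simp
      show "?\<Phi> f w \<le> 2 * m + 1" if "w \<in> V" for w using f(4)[OF that] that flip_le_iff by simp
    qed simp
  qed
qed simp

lemma card_core_through_flip: "card (core_through (flip x)) = card (core_through x)"
  using card_core_through_flip_le[of x] card_core_through_flip_le[of "flip x"] by simp

text \<open>All of \<open>F\<close> is placed in the first clique with one vertex on
  \<open>a\<^sub>0\<close>. This will separate \<open>d\<close>, whose count is below the same
  bound, from every other vertex.\<close>

lemma card_core_through_0: "B ^ (n - 2) \<le> card (core_through 0)"
proof -
  obtain a where a: "a \<in> V" using min_degree_attained by blast
  let ?K = "(*) 2 ` {1..m}"
  have cK: "card ?K = m" by (simp add: card_image inj_on_def)
  have cV: "card (V - {a}) = n - 1" using a card_verts by simp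
  have "(card ?K - card (V - {a})) ^ card (V - {a}) \<le> card (core_through 0)"
  proof (rule card_ge_inj_extensions[where g = "\<lambda>_. 0"])
    fix f assume f: "f \<in> extensional V" "\<And>p. p \<in> {a} \<Longrightarrow> f p = 0" "f ` (V - {a}) \<subseteq> ?K" "inj_on f (V - {a})"
    have fa: "f a = 0" using f(2) by simp
    have Va: "V = insert a (V - {a})" using a by auto
    have "f a \<notin> f ` (V - {a})" using f(3) fa by auto
    then have inj: "inj_on f V" using f(4) inj_on_insert[of f a "V - {a}"] Va by simp
    show "f \<in> core_through 0"
    proof (rule clique_core_through[where Q = "insert 0 ?K"])
      have "f w \<in> insert 0 ?K" if "w \<in> V" for w
        using that f(3) fa by (cases "w = a") blast+
      then show "f ` V \<subseteq> insert 0 ?K" by (rule image_subsetI)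
      show "0 \<in> f ` V" using fa a by force
    qed (use f(1) inj in \<open>auto simp: core_adj_def\<close>)
  qed (use a in auto)
  moreover have "B ^ (n - 2) \<le> (m - (n - 1)) ^ (n - 1)"
  proof -
    have "B ^ (n - 2) \<le> B ^ (n - 1)" using B_ge by (intro power_increasing) auto
    also have "\<dots> \<le> (m - (n - 1)) ^ (n - 1)" by (intro power_mono) (auto simp: m_def)
    finally show ?thesis .
  qed
  ultimately show ?thesis unfolding cK cV by linarith
qed

subsection \<open>Embeddings avoiding \<open>d\<close>\<close>

lemma card_core_through_Suc:
  assumes "i < m"
  shows "card (core_through (2 * i)) + B ^ (n - 2) \<le> card (core_through (2 * Suc i))"
proof -
  let ?x = "2 * i" and ?y = "2 * Suc i" and ?c = "2 * (m - i) + 1"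
  let ?X = "core_through ?x - core_through ?y" and ?Y = "core_through ?y - core_through ?x"
  let ?gain = "{f \<in> ?Y. \<exists>a b. (a, b) \<in> parcs F \<and> f a = ?y \<and> f b = ?c}"
  let ?t = "transpose ?x ?y"
  let ?\<Phi> = "\<lambda>f. restrict (?t \<circ> f) V"
  have inX: "f \<in> core_through ?x \<and> ?y \<notin> f ` V" if "f \<in> ?X" for f
    using that by (auto simp: core_through_def)
  have \<Phi>w: "?\<Phi> f w = (if f w = ?x then ?y else f w)" if "f \<in> ?X" "w \<in> V" for f w
  proof -
    have "f w \<noteq> ?y" using inX[OF that(1)] that(2) by (metis imageI)
    then show ?thesis using that(2) by (simp add: transpose_def)
  qed
  have inj\<Phi>: "inj_on ?\<Phi> ?X"
  proof (rule inj_onI, rule extensionalityI)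
    fix f g assume fg: "f \<in> ?X" "g \<in> ?X" "?\<Phi> f = ?\<Phi> g"
    show "f \<in> extensional V" "g \<in> extensional V" using fg core_embeddingD(1) by auto
    show "f w = g w" if "w \<in> V" for w
      using fun_cong[OF fg(3), of w] that by (simp add: inj_eq)
  qed
  have \<Phi>Y: "?\<Phi> f \<in> ?Y - ?gain" if fX: "f \<in> ?X" for f
  proof -
    have fx: "f \<in> core_through ?x" and ny: "?y \<notin> f ` V" using inX[OF fX] by auto
    note f = core_embeddingD[OF fx]
    have "?\<Phi> f \<in> core_through ?y"
    proof (rule core_throughI)
      show "inj_on (?\<Phi> f) V"
        using comp_inj_on[OF f(2) inj_on_subset[OF inj_transpose subset_UNIV, of ?x ?y]] by simp
      show "?y \<in> ?\<Phi> f ` V"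
      proof -
        obtain u where "u \<in> V" "f u = ?x" using f(3) by auto
        then show ?thesis using \<Phi>w[OF fX, of u] by (metis imageI)
      qed
      show "?\<Phi> f w \<le> 2 * m + 1" if "w \<in> V" for w
        using \<Phi>w[OF fX that] f(4)[OF that] assms by auto
      show "core_adj m (?\<Phi> f u) (?\<Phi> f v)" if uv: "(u, v) \<in> parcs F" for u v
      proof -
        have V: "u \<in> V" "v \<in> V" using uv F.in_arcsD1 F.in_arcsD2 by auto
        then have "f u \<noteq> ?y" "f v \<noteq> ?y" using ny by (metis imageI)+
        then show ?thesis
          using f(5)[OF uv] V assms unfolding \<Phi>w[OF fX V(1)] \<Phi>w[OF fX V(2)]
          by (auto simp: core_adj_def)
      qed
    qed simp
    moreover have "?\<Phi> f w \<noteq> ?x" if "w \<in> V" for w using \<Phi>w[OF fX that] by auto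
    then have "?\<Phi> f \<notin> core_through ?x" by (fastforce simp: core_through_def)
    \<comment> \<open>Undoing the exchange would put this arc on \<open>?x\<close> and
      \<open>?c\<close>, which are not adjacent.\<close>
    moreover have "\<not> (?\<Phi> f a = ?y \<and> ?\<Phi> f b = ?c)" if ab: "(a, b) \<in> parcs F" for a b
    proof
      assume eq: "?\<Phi> f a = ?y \<and> ?\<Phi> f b = ?c"
      have V: "a \<in> V" "b \<in> V" using ab F.in_arcsD1 F.in_arcsD2 by auto
      then have ne: "f a \<noteq> ?y" using ny by (metis imageI)
      have "f a = ?x" using eq ne \<Phi>w[OF fX V(1)] by (metis (full_types))
      moreover have "f b = ?c"
      proof -
        have "?\<Phi> f b = ?c" using eq ..
        then show ?thesis unfolding \<Phi>w[OF fX V(2)] by (simp split: if_splits) presburger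
      qed
      ultimately have "core_adj m ?x ?c" using f(5)[OF ab] by simp
      then show False using assms by (auto simp: core_adj_def)
    qed
    ultimately show ?thesis by blast
  qed
  obtain p where "p \<in> V" "card {q. (p, q) \<in> parcs F} = \<delta>" using min_degree_attained by blast
  then obtain a b where ab: "(a, b) \<in> parcs F" using leave_nbrs by blast
  have V: "a \<in> V" "b \<in> V" "a \<noteq> b" using ab F.in_arcsD1 F.in_arcsD2 F.no_loops' by auto
  let ?P = "{a, b}"
  have cV: "card (V - ?P) = n - 2" using V card_verts by (simp add: card_Diff_subset)
  \<comment> \<open>Free vertices go into a clique that is joined to both \<open>?y\<close> and
    \<open>?c\<close> and avoids \<open>?x\<close>. It is taken in the second clique for large
    \<open>i\<close> and in the first for small \<open>i\<close>, so that about half of the indices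
    are always available.\<close>
  define K where "K = (if m \<le> 2 * i then (\<lambda>k. 2 * k + 1) ` {m - i <.. m} else (*) 2 ` {i + 2..m})"
  have finK: "finite K" by (simp add: K_def)
  have "card K = (if m \<le> 2 * i then i else m - i - 1)"
    using assms by (auto simp: K_def card_image inj_on_def)
  then have cK: "B \<le> card K - (n - 2)" by (auto simp: m_def)
  let ?Q = "insert ?y (insert ?c K)"
  have Q: "core_adj m u v" if "u \<in> ?Q" "v \<in> ?Q" "u \<noteq> v" for u v
    using that assms by (auto simp: K_def core_adj_def split: if_splits)
  have Qle: "u \<le> 2 * m + 1" if "u \<in> ?Q" for u
    using that assms by (auto simp: K_def split: if_splits)
  have Kn: "?y \<notin> K" "?c \<notin> K" "?y \<noteq> ?c" "?x \<notin> ?Q"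
    using assms by (auto simp: K_def) presburger+
  have "B ^ (n - 2) \<le> (card K - card (V - ?P)) ^ card (V - ?P)"
    unfolding cV using cK by (rule power_mono) simp
  also have "\<dots> \<le> card ?gain"
  proof (rule card_ge_inj_extensions[where g = "\<lambda>w. if w = a then ?y else ?c"])
    fix f assume f: "f \<in> extensional V" "\<And>p. p \<in> ?P \<Longrightarrow> f p = (if p = a then ?y else ?c)"
      "f ` (V - ?P) \<subseteq> K" "inj_on f (V - ?P)"
    have fab: "f a = ?y" "f b = ?c" using f(2) V by auto
    have Vab: "V = insert a (insert b (V - ?P))" using V by auto
    have "f b \<notin> f ` (V - ?P)" using f(3) fab Kn by auto
    moreover have "f a \<notin> f ` insert b (V - ?P)" using f(3) fab Kn by auto
    ultimately have inj: "inj_on f V"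
      using f(4) V by (subst Vab) (simp add: inj_on_insert)
    have fQ: "f ` V \<subseteq> ?Q" using f(3) fab by (subst Vab) auto
    have "f \<in> core_through ?y"
      by (rule clique_core_through[OF f(1) inj fQ _ Q Qle]) (use fab V in \<open>metis imageI\<close>)
    moreover have "f \<notin> core_through ?x" using fQ Kn(4) unfolding core_through_def by blast
    ultimately show "f \<in> ?gain" using ab fab by blast
  qed (use V finK in simp_all)
  finally have gain: "B ^ (n - 2) \<le> card ?gain" .
  have "card ?X \<le> card (?Y - ?gain)"
    by (rule card_inj_on_le[OF inj\<Phi>]) (use \<Phi>Y in blast, simp)
  moreover have "card (?Y - ?gain) = card ?Y - card ?gain" by (rule card_Diff_subset) auto
  moreover have "card ?gain \<le> card ?Y" by (rule card_mono) auto
  ultimately have "card ?X + B ^ (n - 2) \<le> card ?Y" using gain by linarith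
  moreover have "card (core_through ?x) = card ?X + card (core_through ?x \<inter> core_through ?y)"
    by (subst card_Un_disjoint[symmetric]) (auto intro!: arg_cong[where f = card])
  moreover have "card (core_through ?y) = card ?Y + card (core_through ?x \<inter> core_through ?y)"
    by (subst card_Un_disjoint[symmetric]) (auto intro!: arg_cong[where f = card])
  ultimately show ?thesis by linarith
qed

lemma card_core_through_mono:
  assumes "x div 2 < y div 2" "y \<le> 2 * m + 1"
  shows "card (core_through x) + B ^ (n - 2) \<le> card (core_through y)"
proof -
  have idx: "card (core_through z) = card (core_through (2 * (z div 2)))" for z
  proof (cases "even z")
    case False
    then have "flip z = 2 * (z div 2)" by (auto simp: flip_def elim!: oddE)
    then show ?thesis using card_core_through_flip[of z] by simp
  qed simp
  have "card (core_through (2 * i)) + B ^ (n - 2) \<le> card (core_through (2 * j))" if "i < j" "j \<le> m" for i j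
    using that
  proof (induction j)
    case (Suc j)
    then show ?case using card_core_through_Suc[of j] by (cases "i = j") force+
  qed simp
  from this[of "x div 2" "y div 2"] show ?thesis using assms idx[of x] idx[of y] by simp
qed

subsection \<open>Embeddings through \<open>d\<close>\<close>

text \<open>The at least \<open>\<delta>\<close> neighbours of the vertex placed on \<open>d\<close>
  inject into the \<open>\<delta>\<close> neighbours of \<open>d\<close>, so both sets have size
  \<open>\<delta>\<close> and \<open>D\<close> is filled completely.\<close>

lemma through_rootE:
  assumes "f \<in> through x"
  obtains p where "p \<in> V" "f p = d" "f ` nbrs p = D" "card (nbrs p) = \<delta>"
    and "\<And>w. w \<in> V \<Longrightarrow> w \<noteq> p \<Longrightarrow> f w \<le> 2 * m + 1"
proof -
  have f: "f \<in> embeddings F G" and "d \<in> f ` V" using assms by (auto simp: through_def)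
  then obtain p where p: "p \<in> V" "f p = d" by auto
  have inj: "inj_on f V" using embeddingsD(2)[OF f] .
  have sub: "f ` nbrs p \<subseteq> D"
    using embeddingsD(4)[OF f] p(2) parcs_G_d(1) by (force simp: nbrs_def)
  have c: "card (f ` nbrs p) = card (nbrs p)"
    using card_image[OF inj_on_subset[OF inj nbrs_subset]] .
  moreover have "card (f ` nbrs p) \<le> \<delta>" using card_mono[OF finite_D sub] card_D by simp
  ultimately have cp: "card (nbrs p) = \<delta>" using min_degree[OF p(1)] by (simp add: nbrs_def)
  then have "f ` nbrs p = D" using card_subset_eq[OF finite_D sub] c card_D by simp
  moreover have "f w \<le> 2 * m + 1" if "w \<in> V" "w \<noteq> p" for w
  proof -
    have "f w \<noteq> d" using inj_onD[OF inj, of w p] that p by auto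
    then show ?thesis using verts_G embeddingsD(3)[OF f that(1)] by blast
  qed
  ultimately show ?thesis using that p cp by blast
qed

text \<open>The root sits on \<open>d\<close> and its \<open>\<delta>\<close> neighbours in
  \<open>D\<close>, with boundedly many options. As \<open>\<delta> \<ge> 2\<close>, at most
  \<open>n - 3\<close> vertices remain free.\<close>

lemma card_through_d: "card (through d) < B ^ (n - 2)"
proof -
  let ?N = "2 * m + 3"
  let ?R = "{p \<in> V. card (nbrs p) = \<delta>}"
  let ?B = "\<lambda>p w. if w = p then {d} else if w \<in> nbrs p then D else {..2 * m + 2}"
  have sub: "through d \<subseteq> (\<Union>p\<in>?R. PiE V (?B p))"
  proof
    fix f assume "f \<in> through d"
    then obtain p where p: "p \<in> V" "f p = d" "f ` nbrs p = D" "card (nbrs p) = \<delta>"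
      and le: "\<And>w. w \<in> V \<Longrightarrow> w \<noteq> p \<Longrightarrow> f w \<le> 2 * m + 1"
      using through_rootE by blast
    have "f \<in> extensional V" using \<open>f \<in> through d\<close> embeddingsD(1) by (auto simp: through_def)
    moreover have "f w \<in> ?B p w" if "w \<in> V" for w
      using p(2,3) le[OF that] by auto
    ultimately have "f \<in> PiE V (?B p)" by (simp only: PiE_iff) blast
    then show "f \<in> (\<Union>p\<in>?R. PiE V (?B p))" using p by blast
  qed
  have each: "card (PiE V (?B p)) \<le> n ^ n * ?N ^ (n - 3)" if "p \<in> ?R" for p
  proof -
    have "card (PiE V (?B p)) = (\<Prod>w\<in>V. card (?B p w))" by (simp add: card_PiE)
    also have "\<dots> \<le> \<delta> ^ card (nbrs p) * ?N ^ (card V - card (nbrs p) - card {p})"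
      by (rule prod_card_le) (use that nbrs_subset m_ge(3) in \<open>auto simp: card_D\<close>)
    also have "\<dots> \<le> n ^ n * ?N ^ (n - 3)"
    proof (rule mult_mono)
      have "\<delta> ^ \<delta> \<le> n ^ \<delta>" using \<delta>_le by (intro power_mono) auto
      also have "\<dots> \<le> n ^ n" using \<delta>_le by (intro power_increasing) auto
      finally show "\<delta> ^ card (nbrs p) \<le> n ^ n" using that by simp
      show "?N ^ (card V - card (nbrs p) - card {p}) \<le> ?N ^ (n - 3)"
        using that card_verts \<delta>_ge by (intro power_increasing) auto
    qed auto
    finally show ?thesis .
  qed
  have "card (through d) \<le> card (\<Union>p\<in>?R. PiE V (?B p))"
  proof (rule card_mono[OF _ sub])
    have "finite (?B p w)" for p w by simp
    then show "finite (\<Union>p\<in>?R. PiE V (?B p))" by (simp add: finite_PiE)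
  qed
  also have "\<dots> \<le> (\<Sum>p\<in>?R. card (PiE V (?B p)))" by (rule card_UN_le) simp
  also have "\<dots> \<le> of_nat (card ?R) * (n ^ n * ?N ^ (n - 3))"
    by (rule sum_bounded_above) (rule each)
  also have "\<dots> \<le> n ^ (n + 4) * (5 * B) ^ (n - 3)"
  proof -
    have "card ?R \<le> n" using card_mono[OF finite_V, of ?R] card_verts by auto
    then have "card ?R * n ^ n \<le> n * n ^ n" by (rule mult_right_mono) simp
    also have "\<dots> = n ^ (n + 1)" by simp
    \<comment> \<open>The exponent is raised to the one in \<open>B_dominates\<close>, which is
      fitted to the later count over quadruples of vertices.\<close>
    also have "\<dots> \<le> n ^ (n + 4)" using \<delta>_le by (intro power_increasing) auto
    finally have "card ?R * n ^ n \<le> n ^ (n + 4)" .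
    moreover have "?N ^ (n - 3) \<le> (5 * B) ^ (n - 3)"
      using B_ge by (intro power_mono) (auto simp: m_def)
    ultimately have "(card ?R * n ^ n) * ?N ^ (n - 3) \<le> n ^ (n + 4) * (5 * B) ^ (n - 3)"
      by (rule mult_mono) auto
    then show ?thesis by (simp add: mult.assoc)
  qed
  also have "\<dots> < B ^ Suc (n - 3)" by (rule power_dominates[OF B_dominates]) simp
  also have "Suc (n - 3) = n - 2" using \<delta>_ge \<delta>_le by simp
  finally show ?thesis .
qed

section \<open>Constructing embeddings through \<open>d\<close> that otherwise stay in the first
  clique\<close>

lemma even_embedding_through:
  assumes "p \<in> V" "f \<in> extensional V" "f p = d" "f ` nbrs p \<subseteq> D" "inj_on f (V - {p})"
    and ev: "\<And>w. w \<in> V - {p} \<Longrightarrow> even (f w) \<and> f w \<le> 2 * m"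
    and "x \<in> f ` V"
  shows "f \<in> through x"
proof -
  have ne: "f w \<noteq> d" if "w \<in> V - {p}" for w using ev[OF that] by (auto simp: d_def)
  have V: "V = insert p (V - {p})" using assms(1) by auto
  have "f p \<notin> f ` (V - {p})" using ne assms(3) by force
  then have inj: "inj_on f V" using assms(5) inj_on_insert[of f p "V - {p}"] V by simp
  have "f \<in> embeddings F G"
  proof (rule embeddingsI)
    show "f w \<in> pverts G" if "w \<in> V" for w
      using ev[of w] assms(3) that by (cases "w = p") (auto simp: d_def)
    show "(f u, f v) \<in> parcs G" if uv: "(u, v) \<in> parcs F" for u v
    proof -
      have uvV: "u \<in> V" "v \<in> V" "u \<noteq> v" using uv F.in_arcsD1 F.in_arcsD2 F.no_loops' by auto
      consider "u = p" | "v = p" | "u \<in> V - {p}" "v \<in> V - {p}" using uvV by blast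
      then show ?thesis
      proof cases
        case 1
        then have "f v \<in> D" using uv assms(4) by (auto simp: nbrs_def)
        then show ?thesis using 1 assms(3) parcs_G_d by simp
      next
        case 2
        then have "f u \<in> D" using parcs_sym[OF uv] assms(4) by (auto simp: nbrs_def)
        then show ?thesis using 2 assms(3) parcs_G_d by simp
      next
        case 3
        have "f u \<noteq> f v" using inj uvV by (auto simp: inj_on_def)
        then have "core_adj m (f u) (f v)" using ev[OF 3(1)] ev[OF 3(2)] by (auto simp: core_adj_def)
        then show ?thesis by (simp add: parcs_host_iff)
      qed
    qed
  qed fact+
  moreover have "d \<in> f ` V" using assms(1,3) by (metis imageI)
  ultimately show ?thesis using assms(7) by (simp add: through_def)
qed

text \<open>
  Mirroring back an embedding in \<open>anchored i\<close> would move a vertex away from \<open>a\<^sub>0\<close>, a neighbour of \<open>d\<close>: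
  these are the embeddings that the mirror map does not reach.
\<close>

definition "anchored i = {f \<in> through (2 * i). (\<forall>w\<in>V. even (f w))
  \<and> (\<exists>u z. (u, z) \<in> parcs F \<and> f u = 2 * i \<and> f z = 0)}"

text \<open>Take \<open>p\<close>, \<open>z\<close>, \<open>u\<close> from \<open>leave_nbrs\<close>
  and place \<open>p\<close> on \<open>d\<close>, \<open>z\<close> on \<open>a\<^sub>0\<close>,
  \<open>u\<close> on \<open>a\<^sub>i\<close> and the other neighbours of \<open>p\<close> on the
  rest of \<open>D\<close>. Since \<open>\<delta> \<le> i\<close>, \<open>a\<^sub>i\<close> lies
  outside \<open>D\<close>. The remaining \<open>n - 2 - \<delta>\<close> vertices are free in the
  rest of the first clique.\<close>

lemma card_anchored:
  assumes "\<delta> \<le> i" "i \<le> m"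
  shows "B ^ (n - 2 - \<delta>) \<le> card (anchored i)"
proof -
  obtain p where p: "p \<in> V" and cp: "card {q. (p, q) \<in> parcs F} = \<delta>" using min_degree_attained by blast
  obtain z u where zu: "(p, z) \<in> parcs F" "u \<in> V" "u \<noteq> p" "(p, u) \<notin> parcs F" "(u, z) \<in> parcs F"
    using leave_nbrs[OF p cp] by blast
  have cN: "card (nbrs p) = \<delta>" using cp by (simp add: nbrs_def)
  have zN: "z \<in> nbrs p" and uN: "u \<notin> nbrs p" using zu by (auto simp: nbrs_def)
  have D0: "0 \<in> D" using \<delta>_ge by (simp add: D_def)
  have "card (nbrs p - {z}) = card (D - {0})" using cN card_D zN D0 by simp
  then obtain b where b: "bij_betw b (nbrs p - {z}) (D - {0})"
    using finite_same_card_bij[of "nbrs p - {z}" "D - {0}"] by auto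
  let ?P = "insert p (insert u (nbrs p))"
  let ?g = "\<lambda>w. if w = p then d else if w = u then 2 * i else if w = z then 0 else b w"
  define K where "K = (*) 2 ` ({\<delta>..m} - {i})"
  have finK: "finite K" by (simp add: K_def)
  have "card K = m - \<delta>" using assms by (simp add: K_def card_image inj_on_def)
  moreover have PV: "?P \<subseteq> V" using p zu(2) nbrs_subset by auto
  have cP: "card (V - ?P) = n - 2 - \<delta>"
  proof -
    have "card ?P = \<delta> + 2" using cN uN zu(3) by simp
    then show ?thesis using card_Diff_subset[of ?P V] PV card_verts by simp
  qed
  ultimately have "B \<le> card K - card (V - ?P)" using m_ge(1) by linarith
  then have "B ^ (n - 2 - \<delta>) \<le> (card K - card (V - ?P)) ^ card (V - ?P)"
    unfolding cP by (rule power_mono) simp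
  also have "\<dots> \<le> card (anchored i)"
  proof (rule card_ge_inj_extensions[where g = ?g])
    fix f assume f: "f \<in> extensional V" "\<And>w. w \<in> ?P \<Longrightarrow> f w = ?g w"
      "f ` (V - ?P) \<subseteq> K" "inj_on f (V - ?P)"
    have fp: "f p = d" and fu: "f u = 2 * i" and fz: "f z = 0"
      using f(2) zu(3) zN uN by auto
    have fb: "f w = b w" if "w \<in> nbrs p - {z}" for w
      using f(2)[of w] that uN by auto
    have fbD: "bij_betw f (nbrs p - {z}) (D - {0})" using b bij_betw_cong[of "nbrs p - {z}" f b] fb by blast
    have im: "f ` (nbrs p - {z}) = D - {0}" using bij_betw_imp_surj_on[OF fbD] .
    have "f ` insert z (nbrs p - {z}) = insert 0 (D - {0})" using fz im by (simp only: image_insert)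
    then have fD: "f ` nbrs p = D" unfolding insert_Diff[OF zN] insert_Diff[OF D0] .
    have "inj_on f (insert z (nbrs p - {z}))"
      unfolding inj_on_insert using fz im bij_betw_imp_inj_on[OF fbD] by simp
    then have injN: "inj_on f (nbrs p)" unfolding insert_Diff[OF zN] .
    have iD: "2 * i \<notin> D" "2 * i \<notin> K" "D \<inter> K = {}" using assms by (auto simp: D_def K_def)
    have Vp: "V - {p} = insert u (nbrs p \<union> (V - ?P))" using zu(2,3) nbrs_subset by auto
    have "f ` nbrs p \<inter> f ` (V - ?P) = {}" using fD f(3) iD(3) by blast
    then have "inj_on f (nbrs p \<union> (V - ?P))"
      using injN f(4) unfolding inj_on_Un by blast
    moreover have "f u \<notin> f ` (nbrs p \<union> (V - ?P))"
      using fu fD f(3) iD by (simp add: image_Un) blast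
    ultimately have inj: "inj_on f (V - {p})"
      unfolding Vp inj_on_insert by blast
    have ev: "even (f w) \<and> f w \<le> 2 * m" if "w \<in> V - {p}" for w
    proof -
      have "f w \<in> insert (2 * i) (D \<union> K)" using that fu fD f(3) unfolding Vp by blast
      then show ?thesis using assms m_ge(3) by (auto simp: D_def K_def)
    qed
    have "f \<in> through (2 * i)"
      by (rule even_embedding_through[OF p f(1) fp _ inj ev]) (use fD fu zu(2) in \<open>auto intro: rev_image_eqI\<close>)
    moreover have "even (f w)" if "w \<in> V" for w
      using ev[of w] fp that by (cases "w = p") (auto simp: d_def)
    ultimately show "f \<in> anchored i" using zu(5) fu fz by (auto simp: anchored_def)
  qed (use PV finK in \<open>auto simp: anchored_def\<close>)
  finally show ?thesis .
qed

text \<open>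
  Only an edge whose ends have indices with sum at most \<open>m\<close> can be destroyed by exchanging \<open>a\<^sub>k\<close> with \<open>c\<^sub>k\<close>
  at one end, and such an edge stays within one clique. So the cluster grown along these edges from
  the vertex on \<open>c\<^sub>i\<close> lies entirely in the second clique, and in particular avoids the neighbours
  of \<open>d\<close>. Since clusters depend on the indices only, mirroring is an involution.
\<close>

definition "transversal f \<longleftrightarrow> inj_on (\<lambda>w. f w div 2) V"

definition "link f = {(a, b) \<in> parcs F. f a div 2 + f b div 2 \<le> m}"

definition "cluster i f = (link f)\<^sup>* `` {u \<in> V. f u div 2 = i}"

definition "mirror i f = restrict (\<lambda>w. if w \<in> cluster i f then flip (f w) else f w) V"

text \<open>Embeddings through \<open>d\<close> that use both \<open>a\<^sub>i\<close> and
  \<open>c\<^sub>i\<close> contribute equally to both counts, so only this set and the next need to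
  be compared.\<close>

definition "even_only i = {f \<in> through (2 * i). 2 * i + 1 \<notin> f ` V}"

definition "odd_only i = {f \<in> through (2 * i + 1). 2 * i \<notin> f ` V}"

section \<open>The mirror map and its properties\<close>

lemma cluster_step: "a \<in> cluster i f \<Longrightarrow> (a, b) \<in> link f \<Longrightarrow> b \<in> cluster i f"
  unfolding cluster_def by (blast intro: rtrancl_into_rtrancl)

lemma mirror_div2: "w \<in> V \<Longrightarrow> mirror i f w div 2 = f w div 2"
  by (simp add: mirror_def)

lemma cluster_mirror: "cluster i (mirror i f) = cluster i f"
proof -
  have "link (mirror i f) = link f"
    using F.in_arcsD1 F.in_arcsD2 by (auto simp: link_def mirror_div2)
  then show ?thesis by (auto simp: cluster_def mirror_div2)
qed

lemma mirror_mirror: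
  assumes "f \<in> extensional V"
  shows "mirror i (mirror i f) = f"
proof (rule extensionalityI)
  show "mirror i (mirror i f) \<in> extensional V" by (simp add: mirror_def)
  show "mirror i (mirror i f) w = f w" if "w \<in> V" for w
  proof -
    have "mirror i (mirror i f) w = (if w \<in> cluster i f then flip (mirror i f w) else mirror i f w)"
      using that by (simp only: mirror_def[of i "mirror i f"] cluster_mirror restrict_apply' )
    then show ?thesis using that by (simp add: mirror_def)
  qed
qed fact

lemma throughD:
  assumes "f \<in> through x"
  shows "f \<in> extensional V" "inj_on f V" "x \<in> f ` V" "d \<in> f ` V"
    and "\<And>w. w \<in> V \<Longrightarrow> f w \<in> pverts G"
    and "\<And>u v. (u, v) \<in> parcs F \<Longrightarrow> (f u, f v) \<in> parcs G"
proof -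
  have f: "f \<in> embeddings F G" and im: "d \<in> f ` V" "x \<in> f ` V"
    using assms by (auto simp: through_def)
  show "f \<in> extensional V" "inj_on f V" "x \<in> f ` V" "d \<in> f ` V"
    using embeddingsD(1,2)[OF f] im by blast+
  show "f w \<in> pverts G" if "w \<in> V" for w using embeddingsD(3)[OF f that] .
  show "(f u, f v) \<in> parcs G" if "(u, v) \<in> parcs F" for u v using embeddingsD(4)[OF f that] .
qed

lemma d_div2: "d div 2 = m + 1"
  by (simp add: d_def)

lemma odd_cluster:
  assumes "f \<in> odd_only i" "i \<le> m" "w \<in> cluster i f"
  shows "w \<in> V \<and> odd (f w) \<and> f w \<le> 2 * m + 1"
proof -
  have f: "f \<in> through (2 * i + 1)" "2 * i \<notin> f ` V" using assms(1) by (auto simp: odd_only_def)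
  obtain u where u: "u \<in> V" "f u div 2 = i" "(u, w) \<in> (link f)\<^sup>*"
    using assms(3) by (auto simp: cluster_def)
  from u(3) show ?thesis
  proof induction
    case base
    have "f u \<noteq> 2 * i" using u(1) f(2) by (metis imageI)
    then have "f u = 2 * i + 1" using u(2) by presburger
    then show ?case using u(1) assms(2) by simp
  next
    case (step a b)
    then have ab: "(a, b) \<in> parcs F" "f a div 2 + f b div 2 \<le> m" by (auto simp: link_def)
    have ne: "f a \<noteq> d" "f b \<noteq> d" using ab(2) d_div2 by auto
    have "core_adj m (f a) (f b)" using throughD(6)[OF f(1) ab(1)] parcs_G_core[OF ne] by simp
    then show ?case using core_adj_parity[OF _ ab(2)] step.IH F.in_arcsD2[OF ab(1)]
      by (auto simp: core_adj_def)
  qed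
qed

lemma parcs_G_sym: "(x, y) \<in> parcs G \<Longrightarrow> (y, x) \<in> parcs G"
  using core_adj_sym[of m x y] unfolding parcs_host_iff by blast

text \<open>Arcs with both ends in the cluster, or neither, clearly survive. An arc leaving the
  cluster is not a link, so its index sum exceeds \<open>m\<close> and its ends stay adjacent as
  long as they stay distinct; transversality guarantees that.\<close>

lemma mirror_odd_only:
  assumes f: "f \<in> odd_only i" and t: "transversal f" and "i \<le> m"
  shows "mirror i f \<in> even_only i" "transversal (mirror i f)"
proof -
  have ft: "f \<in> through (2 * i + 1)" "2 * i \<notin> f ` V" using f by (auto simp: odd_only_def)
  note fD = throughD[OF ft(1)]
  note cl = odd_cluster[OF f assms(3)]
  let ?g = "mirror i f" and ?C = "cluster i f"
  have cne: "f w \<noteq> d" if "w \<in> ?C" for w using cl[OF that] by (auto simp: d_def)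
  have g: "?g w = (if w \<in> ?C then flip (f w) else f w)" if "w \<in> V" for w
    using that by (simp add: mirror_def)
  show tg: "transversal ?g" using t by (simp add: transversal_def mirror_div2 cong: inj_on_cong)
  have ginj: "inj_on ?g V"
    using tg by (auto simp: transversal_def inj_on_def)
  have "?g \<in> embeddings F G"
  proof (rule embeddingsI)
    show "?g \<in> extensional V" by (simp add: mirror_def)
    show "?g w \<in> pverts G" if "w \<in> V" for w
      using fD(5)[OF that] g[OF that] cl[of w] flip_le_iff[of "f w" m] by (auto split: if_splits)
    have half: "(?g a, ?g b) \<in> parcs G"
      if ab: "(a, b) \<in> parcs F" and C: "a \<in> ?C" "b \<notin> ?C" for a b
    proof -
      have V: "a \<in> V" "b \<in> V" "a \<noteq> b" using ab F.in_arcsD1 F.in_arcsD2 F.no_loops' by auto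
      have "(a, b) \<notin> link f" using C cluster_step by blast
      then have big: "m < f a div 2 + f b div 2" using ab by (simp add: link_def)
      have fa: "odd (f a)" "f a \<le> 2 * m + 1" using cl[OF C(1)] by auto
      have "(f a, f b) \<in> parcs G" using fD(6)[OF ab] .
      \<comment> \<open>\<open>d\<close> has only even neighbours, whereas the cluster is
        odd.\<close>
      moreover have "f b \<noteq> d"
      proof
        assume "f b = d"
        then have "f a \<in> D" using fD(6)[OF ab] by (simp only: parcs_G_d)
        then show False using fa(1) by (simp add: D_def)
      qed
      moreover have "f a \<noteq> d" using fa(1) by (auto simp: d_def)
      ultimately have "core_adj m (f a) (f b)" using parcs_G_core by blast
      moreover have "f a div 2 \<noteq> f b div 2" using t V by (auto simp: transversal_def inj_on_def)
      then have "flip (f a) \<noteq> f b" by (metis flip_div2)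
      ultimately have "core_adj m (flip (f a)) (f b)"
        using big flip_le_iff[of "f a" m] by (auto simp: core_adj_def simp del: flip_le_iff)
      then show ?thesis using g V C by (simp add: parcs_host_iff)
    qed
    show "(?g a, ?g b) \<in> parcs G" if ab: "(a, b) \<in> parcs F" for a b
    proof -
      have V: "a \<in> V" "b \<in> V" using ab F.in_arcsD1 F.in_arcsD2 by auto
      consider "a \<in> ?C" "b \<in> ?C" | "a \<notin> ?C" "b \<notin> ?C" | "a \<in> ?C" "b \<notin> ?C" | "a \<notin> ?C" "b \<in> ?C" by blast
      then show ?thesis
      proof cases
        case 1
        then have "f a \<noteq> d" "f b \<noteq> d" using cne by auto
        then have "core_adj m (f a) (f b)" using fD(6)[OF ab] parcs_G_core by blast
        then show ?thesis using g V 1 by (simp add: parcs_host_iff)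
      next
        case 2
        then show ?thesis using fD(6)[OF ab] g V by simp
      next
        case 3
        then show ?thesis using half ab by blast
      next
        case 4
        then have "(?g b, ?g a) \<in> parcs G" using half parcs_sym[OF ab] by blast
        then show ?thesis by (rule parcs_G_sym)
      qed
    qed
  qed fact
  moreover have "d \<in> ?g ` V"
  proof -
    obtain p where "p \<in> V" "f p = d" using fD(4) by auto
    moreover from this have "p \<notin> ?C" using cne by blast
    ultimately show ?thesis using g[of p] by (metis imageI)
  qed
  moreover obtain u where u: "u \<in> V" "f u = 2 * i + 1" using fD(3) by auto
  then have "u \<in> ?C" by (auto simp: cluster_def)
  then have gu: "?g u = 2 * i" using g[OF u(1)] u(2) by simp
  moreover have "?g w \<noteq> 2 * i + 1" if "w \<in> V" for w
  proof
    assume w: "?g w = 2 * i + 1"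
    then have "?g w div 2 = ?g u div 2" using gu by simp
    then have "w = u" using tg that u(1) by (auto simp: transversal_def inj_on_def)
    then show False using w gu by simp
  qed
  moreover have "2 * i \<in> ?g ` V" using gu u(1) by (metis imageI)
  ultimately show "?g \<in> even_only i" by (fastforce simp: even_only_def through_def)
qed

lemma anchored_even_only: "anchored i \<subseteq> even_only i"
proof
  fix f assume f: "f \<in> anchored i"
  have "even (f w)" if "w \<in> V" for w using f that by (auto simp: anchored_def)
  then have "f w \<noteq> 2 * i + 1" if "w \<in> V" for w using that by fastforce
  then have "2 * i + 1 \<notin> f ` V" by force
  then show "f \<in> even_only i" using f by (simp add: anchored_def even_only_def)
qed

text \<open>The arc from \<open>u\<close> to \<open>z\<close> has index sum
  \<open>i \<le> m\<close>, so it is a link and pulls \<open>z\<close> into the cluster, making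
  \<open>f z\<close> odd. But \<open>a\<^sub>0\<close> belongs to \<open>D\<close> and is therefore
  used by \<open>f\<close>; by transversality only \<open>z\<close> could lie on it.\<close>

lemma mirror_not_anchored:
  assumes f: "f \<in> odd_only i" and "transversal f" and "i \<le> m"
  shows "mirror i f \<notin> anchored i"
proof
  assume "mirror i f \<in> anchored i"
  then obtain u z where uz: "(u, z) \<in> parcs F" "mirror i f u = 2 * i" "mirror i f z = 0"
    by (auto simp: anchored_def)
  have V: "u \<in> V" "z \<in> V" using uz(1) F.in_arcsD1 F.in_arcsD2 by auto
  have "f u div 2 = i" "f z div 2 = 0"
    using mirror_div2[OF V(1), of i f] mirror_div2[OF V(2), of i f] uz(2,3) by auto
  then have "(u, z) \<in> link f" using uz(1) assms(3) by (simp add: link_def)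
  then have zC: "z \<in> cluster i f" using \<open>f u div 2 = i\<close> V(1) by (auto simp: cluster_def)
  obtain p where p: "p \<in> V" "f p = d" "f ` nbrs p = D"
    using f through_rootE by (metis (mono_tags, lifting) odd_only_def mem_Collect_eq)
  have "0 \<in> f ` nbrs p" using p(3) \<delta>_ge by (simp add: D_def)
  then obtain z' where "z' \<in> nbrs p" "f z' = 0" by (metis imageE)
  then have z': "z' \<in> V" "f z' = 0" using nbrs_subset by auto
  then have "z' = z"
    using assms(2) V(2) \<open>f z div 2 = 0\<close> by (auto simp: transversal_def inj_on_def)
  then show False using odd_cluster[OF f assms(3) zC] z'(2) by simp
qed

lemma non_transversalE:
  assumes f: "f \<in> odd_only i" and nt: "\<not> transversal f"
  obtains p u a b where "p \<in> V" "u \<in> V" "a \<in> V" "b \<in> V" "card (nbrs p) = \<delta>" "u \<noteq> p" "u \<notin> nbrs p"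
    "b \<noteq> p" "b \<noteq> u" "b \<notin> nbrs p" "a \<noteq> b"
    "f p = d" "f ` nbrs p = D" "f u = 2 * i + 1" "f b = flip (f a)"
proof -
  have ft: "f \<in> through (2 * i + 1)" "2 * i \<notin> f ` V" using f by (auto simp: odd_only_def)
  note fD = throughD[OF ft(1)]
  obtain p where p: "p \<in> V" "f p = d" "f ` nbrs p = D" "card (nbrs p) = \<delta>"
    and le: "\<And>w. w \<in> V \<Longrightarrow> w \<noteq> p \<Longrightarrow> f w \<le> 2 * m + 1"
    using through_rootE[OF ft(1)] by blast
  obtain u where u: "u \<in> V" "f u = 2 * i + 1" using fD(3) by auto
  have ev: "even (f w)" if "w \<in> nbrs p" for w using that p(3) by (auto simp: D_def)
  have up: "u \<noteq> p" "u \<notin> nbrs p" 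
  proof -
    have "even (f p)" "odd (f u)" using p(2) u(2) by (simp_all add: d_def)
    then show "u \<noteq> p" "u \<notin> nbrs p" using ev by auto
  qed
  obtain a b where ab: "a \<in> V" "b \<in> V" "a \<noteq> b" "f a div 2 = f b div 2"
    using nt by (auto simp: transversal_def inj_on_def)
  have ne: "f a \<noteq> f b" using fD(2) ab by (auto simp: inj_on_def)
  have fl: "f b = flip (f a)" "f a = flip (f b)"
    using div2_eqD[OF ab(4) ne] by auto
  have other: "w \<noteq> p \<and> w \<noteq> u" if "w \<in> V" "v \<in> V" "v \<noteq> w" "f v = flip (f w)" for v w
  proof
    show "w \<noteq> u" using that u(2) ft(2) by (metis flip_double(2) imageI Suc_eq_plus1)
    show "w \<noteq> p"
    proof
      assume "w = p"
      then have "f v div 2 = m + 1" using that(4) p(2) d_div2 by simp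
      then show False using le[OF that(2)] that(3) \<open>w = p\<close> by auto
    qed
  qed
  have "a \<notin> nbrs p \<or> b \<notin> nbrs p" using ev[of a] ev[of b] fl(1) by auto
  then show thesis
  proof
    assume "a \<notin> nbrs p"
    then show thesis
      using that[of p u b a] p u up ab fl other[of a b] by metis
  next
    assume "b \<notin> nbrs p"
    then show thesis
      using that[of p u a b] p u up ab fl other[of b a] by metis
  qed
qed

text \<open>For fixed \<open>p\<close>, \<open>u\<close>, \<open>a\<close>, \<open>b\<close>, the
  values at \<open>p\<close>, \<open>u\<close> and \<open>b\<close> are determined and those at the
  neighbours of \<open>p\<close> lie in \<open>D\<close>. Only \<open>n - 3 - \<delta>\<close>
  vertices remain free, one fewer than for anchored embeddings.\<close>

lemma card_non_transversal:
  assumes "\<delta> < n - 2"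
  shows "card {f \<in> odd_only i. \<not> transversal f} < B ^ (n - 2 - \<delta>)"
proof -
  let ?N = "2 * m + 3" and ?S = "{f \<in> odd_only i. \<not> transversal f}"
  let ?R = "{(p, u, a, b). p \<in> V \<and> u \<in> V \<and> a \<in> V \<and> b \<in> V \<and> card (nbrs p) = \<delta> \<and> u \<noteq> p \<and> u \<notin> nbrs p
    \<and> b \<noteq> p \<and> b \<noteq> u \<and> b \<notin> nbrs p \<and> a \<noteq> b}"
  let ?T = "\<lambda>(p, u, a, b). {f \<in> ?S. f p = d \<and> f ` nbrs p = D \<and> f u = 2 * i + 1 \<and> f b = flip (f a)}"
  have finS: "finite ?S" by (simp add: odd_only_def)
  have RV: "?R \<subseteq> V \<times> V \<times> V \<times> V" by auto
  then have finR: "finite ?R" by (rule finite_subset) simp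
  have sub: "?S \<subseteq> (\<Union>r\<in>?R. ?T r)"
  proof
    fix f assume fS: "f \<in> ?S"
    then have "f \<in> odd_only i" "\<not> transversal f" by auto
    from non_transversalE[OF this] obtain p u a b where
      "(p, u, a, b) \<in> ?R" "f p = d" "f ` nbrs p = D" "f u = 2 * i + 1" "f b = flip (f a)"
      by (smt (verit) case_prodI mem_Collect_eq)
    then show "f \<in> (\<Union>r\<in>?R. ?T r)" using fS by blast
  qed
  have each: "card (?T r) \<le> n ^ n * ?N ^ (n - 3 - \<delta>)" if "r \<in> ?R" for r
  proof -
    obtain p u a b where r: "r = (p, u, a, b)" by (cases r) auto
    have pu: "p \<in> V" "u \<in> V" "a \<in> V" "b \<in> V" "card (nbrs p) = \<delta>" "u \<noteq> p" "u \<notin> nbrs p"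
      "b \<noteq> p" "b \<noteq> u" "b \<notin> nbrs p" "a \<noteq> b" using that r by auto
    let ?V = "V - {b}"
    let ?B = "\<lambda>w. if w = p then {d} else if w = u then {2 * i + 1} else if w \<in> nbrs p then D else {..2 * m + 2}"
    have fext: "f \<in> extensional V" and fG: "\<And>w. w \<in> V \<Longrightarrow> f w \<in> pverts G" if "f \<in> ?S" for f
      using that throughD[of f "2 * i + 1"] by (auto simp: odd_only_def)
    have finB: "finite (PiE ?V ?B)" by (intro finite_PiE) simp_all
    have "card (?T r) \<le> card (PiE ?V ?B)"
    proof (rule card_inj_on_le[OF _ _ finB])
      \<comment> \<open>Dropping \<open>b\<close> loses nothing, since \<open>f b\<close> is
        recovered as \<open>flip (f a)\<close> and \<open>a \<noteq> b\<close>.\<close>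
      show "inj_on (\<lambda>f. restrict f ?V) (?T r)"
      proof (rule inj_onI, rule extensionalityI)
        fix f g assume f: "f \<in> ?T r" and g: "g \<in> ?T r" and eq: "restrict f ?V = restrict g ?V"
        show "f \<in> extensional V" "g \<in> extensional V" using f g fext r by auto
        have same: "f w = g w" if "w \<in> ?V" for w
          using fun_cong[OF eq, of w] that by simp
        have "f a = g a" using same pu(3,11) by blast
        then have "f b = g b" using f g r by simp
        then show "f w = g w" if "w \<in> V" for w using same that by (cases "w = b") auto
      qed
      show "(\<lambda>f. restrict f ?V) ` ?T r \<subseteq> PiE ?V ?B"
      proof (rule image_subsetI)
        fix f assume f: "f \<in> ?T r"
        then have "f \<in> ?S" "f p = d" "f ` nbrs p = D" "f u = 2 * i + 1" using r by auto
        then have "f w \<in> ?B w" if "w \<in> ?V" for w using fG[of f w] that by auto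
        then show "restrict f ?V \<in> PiE ?V ?B" by (simp only: restrict_PiE_iff) blast
      qed
    qed
    also have "\<dots> = (\<Prod>w\<in>?V. card (?B w))" by (simp add: card_PiE)
    also have "\<dots> \<le> \<delta> ^ card (nbrs p) * ?N ^ (card ?V - card (nbrs p) - card {p, u})"
      by (rule prod_card_le) (use pu nbrs_subset[of p] m_ge(3) in \<open>auto simp: card_D\<close>)
    also have "\<dots> \<le> n ^ n * ?N ^ (n - 3 - \<delta>)"
    proof (rule mult_mono)
      have "\<delta> ^ \<delta> \<le> n ^ \<delta>" using \<delta>_le by (intro power_mono) auto
      also have "\<dots> \<le> n ^ n" using \<delta>_le by (intro power_increasing) auto
      finally show "\<delta> ^ card (nbrs p) \<le> n ^ n" using pu by simp
      show "?N ^ (card ?V - card (nbrs p) - card {p, u}) \<le> ?N ^ (n - 3 - \<delta>)"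
        using pu card_verts by (intro power_increasing) auto
    qed auto
    finally show ?thesis .
  qed
  have "card ?S \<le> card (\<Union>r\<in>?R. ?T r)"
    by (rule card_mono[OF _ sub], rule finite_subset[OF _ finS]) auto
  also have "\<dots> \<le> (\<Sum>r\<in>?R. card (?T r))" by (rule card_UN_le[OF finR])
  also have "\<dots> \<le> of_nat (card ?R) * (n ^ n * ?N ^ (n - 3 - \<delta>))"
    by (rule sum_bounded_above) (rule each)
  also have "\<dots> \<le> n ^ (n + 4) * (5 * B) ^ (n - 3 - \<delta>)"
  proof -
    have "card ?R \<le> card (V \<times> V \<times> V \<times> V)" by (rule card_mono[OF _ RV]) simp
    also have "\<dots> = n ^ 4" by (simp add: card_cartesian_product card_verts power4_eq_xxxx mult.assoc)
    finally have "card ?R * n ^ n \<le> n ^ 4 * n ^ n" by (rule mult_right_mono) simp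
    then have "card ?R * n ^ n \<le> n ^ (n + 4)" by (simp add: power_add mult.commute)
    moreover have "?N ^ (n - 3 - \<delta>) \<le> (5 * B) ^ (n - 3 - \<delta>)"
      using B_ge by (intro power_mono) (auto simp: m_def)
    ultimately have "(card ?R * n ^ n) * ?N ^ (n - 3 - \<delta>) \<le> n ^ (n + 4) * (5 * B) ^ (n - 3 - \<delta>)"
      by (rule mult_mono) auto
    then show ?thesis by (simp add: mult.assoc)
  qed
  also have "\<dots> < B ^ Suc (n - 3 - \<delta>)" by (rule power_dominates[OF B_dominates]) simp
  also have "Suc (n - 3 - \<delta>) = n - 2 - \<delta>" using assms by simp
  finally show ?thesis .
qed

text \<open>In this case the anchored bound is only \<open>B ^ 0 = 1\<close>, so there must be no
  exception at all. Indeed \<open>p\<close>, its neighbours, \<open>u\<close> and \<open>b\<close>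
  would be \<open>\<delta> + 3 > n\<close> distinct vertices.\<close>

lemma transversal_if_tight:
  assumes "f \<in> odd_only i" "\<delta> = n - 2"
  shows "transversal f"
proof (rule ccontr)
  assume "\<not> transversal f"
  from non_transversalE[OF assms(1) this] obtain p u b
    where pub: "p \<in> V" "u \<in> V" "b \<in> V" "card (nbrs p) = \<delta>" "u \<noteq> p" "u \<notin> nbrs p"
      "b \<noteq> p" "b \<noteq> u" "b \<notin> nbrs p" by metis
  have "card (insert p (insert u (insert b (nbrs p)))) = \<delta> + 3" using pub by simp
  moreover have "card (insert p (insert u (insert b (nbrs p)))) \<le> n"
    unfolding card_verts[symmetric] by (rule card_mono) (use pub nbrs_subset in auto)
  ultimately show False using assms(2) \<delta>_le by simp
qed

text \<open>The mirror map injects the transversal part of \<open>odd_only i\<close> into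
  \<open>even_only i\<close> minus \<open>anchored i\<close>, and the anchored embeddings outnumber
  the non-transversal ones.\<close>

lemma card_odd_less_even_only:
  assumes "\<delta> \<le> i" "i \<le> m"
  shows "card (odd_only i) < card (even_only i)"
proof -
  let ?T = "{f \<in> odd_only i. transversal f}" and ?S = "{f \<in> odd_only i. \<not> transversal f}"
  have fin: "finite (odd_only i)" "finite (even_only i)"
    by (simp_all add: odd_only_def even_only_def)
  have inj: "inj_on (mirror i) ?T"
  proof (rule inj_on_inverseI[where g = "mirror i"])
    fix f assume "f \<in> ?T"
    then have "f \<in> extensional V" using throughD(1) by (auto simp: odd_only_def)
    then show "mirror i (mirror i f) = f" by (rule mirror_mirror)
  qed
  have disj: "mirror i ` ?T \<inter> anchored i = {}" using mirror_not_anchored assms(2) by auto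
  have "card ?T + card (anchored i) = card (mirror i ` ?T \<union> anchored i)"
    using disj fin anchored_even_only[of i] inj
    by (subst card_Un_disjoint) (auto simp: card_image intro: finite_subset)
  also have "\<dots> \<le> card (even_only i)"
    by (rule card_mono[OF fin(2)]) (use mirror_odd_only(1) assms(2) anchored_even_only in auto)
  finally have "card ?T + B ^ (n - 2 - \<delta>) \<le> card (even_only i)"
    using card_anchored[OF assms] by linarith
  moreover have "card ?S < B ^ (n - 2 - \<delta>)"
  proof (cases "\<delta> < n - 2")
    case True
    then show ?thesis by (rule card_non_transversal)
  next
    case False
    then have "\<delta> = n - 2" using \<delta>_le by simp
    then have "?S = {}" using transversal_if_tight by blast
    then show ?thesis using B_ge by (simp only: card.empty) simp
  qed
  moreover have "card (odd_only i) = card ?T + card ?S"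
    using fin(1) by (subst card_Un_disjoint[symmetric]) (auto intro!: arg_cong[where f = card])
  ultimately show ?thesis by linarith
qed

lemma card_through_odd_less:
  assumes "i \<le> m"
  shows "card (through (2 * i + 1)) < card (through (2 * i))"
proof (cases "\<delta> \<le> i")
  case True
  let ?I = "through (2 * i) \<inter> through (2 * i + 1)"
  have "card (through (2 * i)) = card (even_only i) + card ?I"
    by (subst card_Un_disjoint[symmetric])
      (auto simp: even_only_def through_def intro!: arg_cong[where f = card])
  moreover have "card (through (2 * i + 1)) = card (odd_only i) + card ?I"
    by (subst card_Un_disjoint[symmetric])
      (auto simp: odd_only_def through_def intro!: arg_cong[where f = card])
  ultimately show ?thesis using card_odd_less_even_only[OF True assms] by linarith
next
  \<comment> \<open>For \<open>i < \<delta>\<close>, \<open>a\<^sub>i\<close> is a neighbour of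
    \<open>d\<close> and so lies in every copy through \<open>d\<close>; it suffices to find one
    such copy that avoids \<open>c\<^sub>i\<close>.\<close>
  case False
  have sub: "through x \<subseteq> through d" for x by (auto simp: through_def)
  have "through d \<subseteq> through (2 * i)"
  proof
    fix f assume f: "f \<in> through d"
    then obtain p where "f ` nbrs p = D" using through_rootE by metis
    moreover have "2 * i \<in> D" using False by (simp add: D_def)
    ultimately have "2 * i \<in> f ` V" using nbrs_subset by blast
    then show "f \<in> through (2 * i)" using f by (simp add: through_def)
  qed
  then have eq: "through (2 * i) = through d" using sub by blast
  \<comment> \<open>Any anchored embedding will do, since it takes only even values;
    \<open>m\<close> is an admissible index because \<open>\<delta> \<le> m\<close>.\<close>
  have "0 < card (anchored m)"
    using card_anchored[OF m_ge(3) order_refl] B_ge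
    by (metis less_le_trans zero_less_power add_gr_0 zero_less_numeral)
  then obtain f where f: "f \<in> anchored m" by (metis card_gt_0_iff ex_in_conv)
  then have ev: "even (f w)" if "w \<in> V" for w using that by (auto simp: anchored_def)
  have "f \<in> through d" using f sub by (auto simp: anchored_def)
  moreover have "2 * i + 1 \<notin> f ` V"
  proof
    assume "2 * i + 1 \<in> f ` V"
    then obtain w where "w \<in> V" "f w = 2 * i + 1" by auto
    then show False using ev[of w] by simp
  qed
  then have "f \<notin> through (2 * i + 1)" by (simp add: through_def)
  ultimately have "through (2 * i + 1) \<subset> through (2 * i)" using sub eq by blast
  then show ?thesis by (intro psubset_card_mono) simp_all
qed

text \<open>Embeddings through \<open>d\<close> number fewer than \<open>B ^ (n - 2)\<close>, so
  they cannot upset the order of distinct indices given by the core counts. The vertex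
  \<open>d\<close> lies below all others, and the two vertices of equal index differ by
  \<open>card_through_odd_less\<close>.\<close>

lemma F_irregular_host: "F_irregular F G"
proof (rule F_irregularI)
  show "pair_graph F" by (rule F.pair_graph)
  show "pair_graph G" by (rule pair_graph_host) (use m_ge(3) in simp)
  let ?e = "\<lambda>v. card {f \<in> embeddings F G. v \<in> f ` V}"
  have split: "?e v = card (core_through v) + card (through v)" for v
    by (subst card_Un_disjoint[symmetric])
      (auto simp: core_through_def through_def intro!: arg_cong[where f = card])
  have thr: "card (through v) < B ^ (n - 2)" for v
  proof -
    have "card (through v) \<le> card (through d)" by (rule card_mono) (auto simp: through_def)
    then show ?thesis using card_through_d by simp
  qed
  have "core_through d = {}" by (auto simp: core_through_def)
  then have ed: "?e d < B ^ (n - 2)" using split[of d] thr[of d] by simp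
  have core: "B ^ (n - 2) \<le> card (core_through v)" if "v \<le> 2 * m + 1" for v
  proof (cases "v div 2 = 0")
    case True
    then have "v = 0 \<or> v = flip 0" by (auto simp: flip_def)
    then show ?thesis using card_core_through_0 card_core_through_flip[of 0] by auto
  next
    case False
    then show ?thesis using card_core_through_mono[of 0 v] that by simp
  qed
  have less: "?e v < ?e w" if "v div 2 < w div 2" "w \<le> 2 * m + 1" for v w
    using card_core_through_mono[OF that] thr[of v] split[of v] split[of w] by linarith
  have flip: "?e (flip v) \<noteq> ?e v" if "v \<le> 2 * m + 1" for v
  proof -
    have even: "?e (2 * i + 1) < ?e (2 * i)" if "i \<le> m" for i
      using card_through_odd_less[OF that] card_core_through_flip[of "2 * i"]
        split[of "2 * i"] split[of "2 * i + 1"] by simp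
    have "v div 2 \<le> m" using that by simp
    from even[OF this] show ?thesis by (cases "even v") (auto simp: flip_def elim!: evenE oddE)
  qed
  show "inj_on ?e (pverts G)"
  proof (rule inj_onI, rule ccontr)
    fix v w assume v: "v \<in> pverts G" and w: "w \<in> pverts G" and eq: "?e v = ?e w" and "v \<noteq> w"
    consider "v = d" "w \<le> 2 * m + 1" | "w = d" "v \<le> 2 * m + 1" | "v \<le> 2 * m + 1" "w \<le> 2 * m + 1"
      using v w \<open>v \<noteq> w\<close> verts_G by blast
    then show False
    proof cases
      case 1
      then show False using eq ed core[of w] split[of w] by simp
    next
      case 2
      then show False using eq ed core[of v] split[of v] by simp
    next
      case 3
      show False
      proof (cases "v div 2 = w div 2")
        case True
        then have "w = flip v" using \<open>v \<noteq> w\<close> by (rule div2_eqD)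
        then show False using flip[OF 3(1)] eq by simp
      next
        case False
        then consider "v div 2 < w div 2" | "w div 2 < v div 2" by linarith
        then show False using less[of v w] less[of w v] 3 eq by cases linarith+
      qed
    qed
  qed
qed

end

section \<open>The theorem\<close>

text \<open>Otherwise \<open>S\<close> would be closed under arcs and contain everything reachable
  from \<open>s\<close>.\<close>

lemma (in pair_graph) connected_edge_leaving:
  assumes "connected (with_proj G)" "s \<in> S" "S \<subset> pverts G"
  obtains x y where "x \<in> S" "y \<in> pverts G" "y \<notin> S" "(x, y) \<in> parcs G"
proof -
  note leaving = that
  show thesis
  proof (rule ccontr)
    assume nt: "\<not> thesis"
    have closed: "y \<in> S" if xy: "x \<in> S" "(x, y) \<in> parcs G" for x y
    proof (rule ccontr)
      assume "y \<notin> S"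
      from leaving[OF xy(1) in_arcsD2[OF xy(2)] this xy(2)] nt show False by contradiction
    qed
    \<comment> \<open>Connectedness refers to the symmetric closure, which changes nothing for
      symmetric arcs.\<close>
    have sym: "parcs (mk_symmetric (with_proj G)) = parcs G"
      using adj_mk_symmetric_eq[OF pair_sym_arcs] .
    obtain t where t: "t \<in> pverts G" "t \<notin> S" using assms(3) by auto
    have "s \<rightarrow>\<^sup>*\<^bsub>with_proj (mk_symmetric (with_proj G))\<^esub> t"
      using assms t(1) by (auto simp: connected_def strongly_connected_def)
    then have "(s, t) \<in> rtrancl_on (pverts G) (parcs G)"
      by (simp add: reachable_def sym)
    then have "t \<in> S"
      by (induction rule: rtrancl_on_induct) (use assms(2) closed in auto)
    then show False using t(2) by simp
  qed
qed

text \<open>An empty walk or a single arc joins any two vertices. Contraposed, diameter at least 2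
  yields two distinct non-adjacent vertices.\<close>

lemma (in pair_graph) graph_diameter_complete:
  assumes "\<And>u v. u \<in> pverts G \<Longrightarrow> v \<in> pverts G \<Longrightarrow> u \<noteq> v \<Longrightarrow> (u, v) \<in> parcs G"
  shows "graph_diameter G \<le> 1"
  unfolding graph_diameter_def
proof (intro SUP_least)
  fix u v assume uv: "u \<in> pverts G" "v \<in> pverts G"
  show "\<mu> (\<lambda>_. 1) u v \<le> 1"
  proof (cases "u = v")
    case True
    have "awalk u [] u" using uv by (simp add: awalk_Nil_iff)
    from min_cost_le_walk_cost[OF this, of "\<lambda>_. 1"] have "\<mu> (\<lambda>_. 1) u v \<le> 0"
      using True by (simp add: awalk_cost_def zero_ereal_def)
    also have "\<dots> \<le> 1" by simp
    finally show ?thesis .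
  next
    case False
    then have "awalk u [(u, v)] v" using assms uv by (simp add: awalk_simps)
    from min_cost_le_walk_cost[OF this, of "\<lambda>_. 1"] show ?thesis
      by (simp add: awalk_cost_def one_ereal_def)
  qed
qed

theorem mainTheorem3:
  fixes F :: "'a pair_pre_digraph" and n :: nat
  assumes "n \<ge> 3"
    and "pair_graph F"
    and "card (pverts F) = n"
    and "connected (with_proj F)"
    and "graph_diameter F \<ge> 2"
    and "\<not> (\<exists>v. pendant F v)"
  shows "\<exists>S :: nat pair_pre_digraph set. infinite S
    \<and> (\<forall>G\<in>S. pair_graph G \<and> F_irregular F G)
    \<and> (\<forall>G\<in>S. \<forall>H\<in>S. G \<noteq> H \<longrightarrow> \<not> digraph_iso (with_proj G) (with_proj H))"
proof -
  interpret F: pair_graph F by fact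
  let ?V = "pverts F"
  let ?N = "\<lambda>p. {q. (p, q) \<in> parcs F}"
  define \<delta> where "\<delta> = Min ((\<lambda>p. card (?N p)) ` ?V)"
  have ne: "?V \<noteq> {}" using assms(1,3) by auto
  have fin: "finite ?V" by (rule F.pair_finite_verts)
  have NV: "?N p \<subseteq> ?V" for p using F.in_arcsD2 by auto
  have finN: "finite (?N p)" for p using NV fin by (rule finite_subset)
  have min: "\<delta> \<le> card (?N p)" if "p \<in> ?V" for p
    unfolding \<delta>_def by (rule Min_le) (use fin that in auto)
  have att: "\<exists>p\<in>?V. card (?N p) = \<delta>"
  proof -
    have "\<delta> \<in> (\<lambda>p. card (?N p)) ` ?V"
      unfolding \<delta>_def by (rule Min_in) (use fin ne in auto)
    then show ?thesis by auto
  qed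
  \<comment> \<open>Connectedness excludes degree 0, and the absence of pendant vertices excludes
    degree 1.\<close>
  have deg: "2 \<le> card (?N p)" if p: "p \<in> ?V" for p
  proof -
    have "?V \<noteq> {p}" using assms(1,3) by auto
    then have "{p} \<subset> ?V" using p by auto
    then obtain y where "(p, y) \<in> parcs F"
      using F.connected_edge_leaving[OF assms(4), of p "{p}"] by blast
    then have "card (?N p) \<noteq> 0" using finN by auto
    moreover have "out_degree (with_proj F) p = card (?N p)"
    proof -
      have "out_arcs (with_proj F) p = Pair p ` ?N p" by (auto simp: out_arcs_def)
      then show ?thesis by (simp add: out_degree_def card_image inj_on_def)
    qed
    then have "card (?N p) \<noteq> 1" using assms(6) p by (auto simp: pendant_def)
    ultimately show ?thesis by linarith
  qed
  have "\<not> graph_diameter F \<le> 1"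
  proof
    assume "graph_diameter F \<le> 1"
    with assms(5) have "(2 :: ereal) \<le> 1" by (rule order_trans)
    then show False by simp
  qed
  then obtain u v where uv: "u \<in> ?V" "v \<in> ?V" "u \<noteq> v" "(u, v) \<notin> parcs F"
    using F.graph_diameter_complete by blast
  have "\<delta> + 2 \<le> n"
  proof -
    \<comment> \<open>The non-adjacent pair bounds the degree of \<open>u\<close>, and hence
      \<open>\<delta>\<close>, by \<open>n - 2\<close>.\<close>
    have "card (insert u (insert v (?N u))) = card (?N u) + 2"
    proof -
      have "v \<notin> ?N u" "u \<notin> insert v (?N u)" using uv F.no_loops' by auto
      then show ?thesis using finN by simp
    qed
    moreover have "card (insert u (insert v (?N u))) \<le> n"
      unfolding assms(3)[symmetric] by (rule card_mono) (use fin uv NV in auto)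
    ultimately show ?thesis using min[OF uv(1)] by linarith
  qed
  \<comment> \<open>The fixed summands secure both bounds on \<open>B\<close>; \<open>k\<close>
    enumerates the hosts.\<close>
  define B where "B k = n ^ (n + 4) * 5 ^ n + 4 * n + 8 + k" for k :: nat
  have inst: "host_setup F n \<delta> (B k)" for k
  proof (unfold_locales)
    show "card ?V = n" by fact
    show "2 \<le> \<delta>" using att deg by auto
    show "\<delta> \<le> card (?N p)" if "p \<in> ?V" for p using min[OF that] .
    show "\<exists>z u. (p, z) \<in> parcs F \<and> u \<in> ?V \<and> u \<noteq> p \<and> (p, u) \<notin> parcs F \<and> (u, z) \<in> parcs F"
      if p: "p \<in> ?V" "card (?N p) = \<delta>" for p
    proof -
      have "card (insert p (?N p)) < card ?V"
        using p(2) \<open>\<delta> + 2 \<le> n\<close> assms(3) card_insert_le_m1[of "\<delta> + 1" "?N p" p] by simp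
      moreover have "insert p (?N p) \<subseteq> ?V" using p(1) NV by auto
      ultimately have sub: "insert p (?N p) \<subset> ?V" by auto
      \<comment> \<open>Here \<open>x\<close> cannot be \<open>p\<close>, as \<open>y\<close> is not
        a neighbour of \<open>p\<close>; so \<open>x\<close> and \<open>y\<close> serve as
        \<open>z\<close> and \<open>u\<close>.\<close>
      obtain x y where "x \<in> insert p (?N p)" "y \<in> ?V" "y \<notin> insert p (?N p)" "(x, y) \<in> parcs F"
        by (rule F.connected_edge_leaving[OF assms(4) insertI1 sub])
      moreover from this have "(y, x) \<in> parcs F"
        using F.pair_sym_arcs by (auto simp: symmetric_def sym_def)
      ultimately show ?thesis by blast
    qed
  qed (use att \<open>\<delta> + 2 \<le> n\<close> in \<open>auto simp: B_def\<close>)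
  let ?G = "\<lambda>k. host \<delta> (host_setup.m n (B k))"
  have m: "host_setup.m n (B k) = 2 * B k + 2 * n + 2" for k
    by (rule host_setup.m_def[OF inst])
  \<comment> \<open>Distinct values of \<open>k\<close> give hosts of distinct orders, which are
    therefore not isomorphic.\<close>
  have card_G: "card (pverts (?G k)) = 4 * k + card (pverts (?G 0))" for k
    unfolding m pverts_host by (simp add: B_def)
  have "inj ?G"
  proof (rule injI)
    fix k l assume "?G k = ?G l"
    then have "card (pverts (?G k)) = card (pverts (?G l))" by simp
    then show "k = l" using card_G[of k] card_G[of l] by linarith
  qed
  then have "infinite (range ?G)" by (rule range_inj_infinite)
  moreover have pg: "pair_graph (?G k)" for k
    by (rule pair_graph_host) (use \<open>\<delta> + 2 \<le> n\<close> in \<open>simp add: m\<close>)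
  moreover have "F_irregular F (?G k)" for k
    by (rule host_setup.F_irregular_host[OF inst])
  moreover have "\<not> digraph_iso (with_proj (?G k)) (with_proj (?G l))" if "?G k \<noteq> ?G l" for k l
  proof
    assume "digraph_iso (with_proj (?G k)) (with_proj (?G l))"
    moreover interpret G: pair_graph "?G k" by (rule pg)
    have "pair_wf_digraph (?G k)" by unfold_locales
    ultimately obtain f where "inj_on f (pverts (?G k))" "?G l = image_graph f (?G k)"
      using digraph_iso_iff_image_graph by blast
    then have "card (pverts (?G l)) = card (pverts (?G k))" by (metis card_image image_graph_simps(1))
    then have "k = l" using card_G[of k] card_G[of l] by linarith
    then show False using that by simp
  qed
  ultimately show ?thesis by (intro exI[of _ "range ?G"]) blast
qed

end
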